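(* Let $n\ge 2$ and $M=\{m_1<m_2<\dots<m_t\}\subseteq[0,n-1]$, and put $m_{t+1}:=n$. Let $D(M)=\{\gamma\in D_n\mid \operatorname{Des}_D(\gamma^{-1})\subseteq M\}$ and $C=\begin{bmatrix} n\\ m_1,\ m_2-m_1,\ \dots,\ n-m_t\end{bmatrix}_q$. Then $$\sum_{\gamma\in D(M)} q^{\operatorname{dmaj}(\gamma)}=\sum_{\gamma\in D(M)} q^{\ell_D(\gamma)}=\begin{cases} C\prod_{i=1}^{n-1}(1+q^i) & \text{if } 0\in M,\\ C\prod_{i=m_1}^{n-1}(1+q^i) & \text{if } 0\notin M,\ 1\notin M,\\ C\,\dfrac{\prod_{i=1}^{n-1}(1+q^i)}{[m_2]_q} & \text{if } 0\notin M,\ 1\in M.\end{cases}$$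
   Context: $B_n$ is the group of bijections $\beta$ of $[-n,n]\setminus\{0\}$ with $\beta(-i)=-\beta(i)$, composed as functions, in window notation $[\beta(1),\dots,\beta(n)]$; $D_n\subseteq B_n$ is the subgroup of those with an even number of negative entries among $\beta(1),\dots,\beta(n)$. For $\gamma\in D_n$: $\operatorname{Des}_D(\gamma)=\{i\in[0,n-1]\mid\gamma(i)>\gamma(i+1)\}$ with $\gamma(0):=-\gamma(2)$; $\operatorname{Des}(\gamma)=\{i\in[n-1]\mid\gamma(i)>\gamma(i+1)\}$, $\operatorname{maj}(\gamma)=\sum_{i\in\operatorname{Des}(\gamma)}i$; $\operatorname{inv}(\gamma)=|\{(i,j):1\le i<j\le n,\gamma(i)>\gamma(j)\}|$; $\operatorname{N}_2(\gamma)=|\{\{i,j\}\subseteq[n],i\ne j:\gamma(i)+\gamma(j)<0\}|$. $\ell_D(\gamma)=\operatorname{inv}(\gamma)+\operatorname{N}_2(\gamma)$ (the Coxeter length of type $D$) and $\operatorname{dmaj}(\gamma)=\operatorname{maj}(\gamma)+\operatorname{N}_2(\gamma)$. $[k]_q=1+q+\dots+q^{k-1}$, $[k]_q!=[k]_q\cdots[1]_q$ ($[0]_q!=1$), $\begin{bmatrix} n\\ a_1,\dots,a_s\end{bmatrix}_q=\frac{[n]_q!}{[a_1]_q!\cdots[a_s]_q!}$. *)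

theory Defs
  imports
    "HOL-Combinatorics.Permutations"
    "HOL-Computational_Algebra.Polynomial"
    "HOL-Computational_Algebra.Fraction_Field"
begin

text \<open>Elements of the signed permutation group are functions on all of \<open>int\<close>, fixing every
  point outside the set they permute; the group operations are then \<open>\<circ>\<close> and \<open>inv\<close>.\<close>

definition B_group :: "nat \<Rightarrow> (int \<Rightarrow> int) set" where
  "B_group n = {\<beta>. \<beta> permutes ({- int n..int n} - {0}) \<and>
                    (\<forall>i\<in>{- int n..int n} - {0}. \<beta> (- i) = - \<beta> i)}"

definition D_group :: "nat \<Rightarrow> (int \<Rightarrow> int) set" where
  "D_group n = {\<gamma>\<in>B_group n. even (card {i\<in>{1..n}. \<gamma> (int i) < 0})}"

text \<open>The convention \<open>\<gamma>(0) := -\<gamma>(2)\<close> is local to type D descents; the underlying function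
  satisfies \<open>\<gamma> 0 = 0\<close>.\<close>

definition Des_D :: "nat \<Rightarrow> (int \<Rightarrow> int) \<Rightarrow> nat set" where
  "Des_D n \<gamma> = {i\<in>{0..n-1}. (if i = 0 then - \<gamma> 2 else \<gamma> (int i)) > \<gamma> (int (i + 1))}"

definition Des :: "nat \<Rightarrow> (int \<Rightarrow> int) \<Rightarrow> nat set" where
  "Des n \<gamma> = {i\<in>{1..n-1}. \<gamma> (int i) > \<gamma> (int (i + 1))}"

definition maj :: "nat \<Rightarrow> (int \<Rightarrow> int) \<Rightarrow> nat" where
  "maj n \<gamma> = (\<Sum>i\<in>Des n \<gamma>. i)"

definition inversion_number :: "nat \<Rightarrow> (int \<Rightarrow> int) \<Rightarrow> nat" where
  "inversion_number n \<gamma> = card {(i, j). 1 \<le> i \<and> i < j \<and> j \<le> n \<and> \<gamma> (int i) > \<gamma> (int j)}"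

definition N2 :: "nat \<Rightarrow> (int \<Rightarrow> int) \<Rightarrow> nat" where
  "N2 n \<gamma> = card {{i, j} |i j. i \<in> {1..n} \<and> j \<in> {1..n} \<and> i \<noteq> j \<and> \<gamma> (int i) + \<gamma> (int j) < 0}"

definition length_D :: "nat \<Rightarrow> (int \<Rightarrow> int) \<Rightarrow> nat" where
  "length_D n \<gamma> = inversion_number n \<gamma> + N2 n \<gamma>"

definition dmaj :: "nat \<Rightarrow> (int \<Rightarrow> int) \<Rightarrow> nat" where
  "dmaj n \<gamma> = maj n \<gamma> + N2 n \<gamma>"

definition D_of :: "nat \<Rightarrow> nat set \<Rightarrow> (int \<Rightarrow> int) set" where
  "D_of n M = {\<gamma>\<in>D_group n. Des_D n (inv \<gamma>) \<subseteq> M}"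

definition q_int :: "'a::field \<Rightarrow> nat \<Rightarrow> 'a" where
  "q_int q k = (\<Sum>i<k. q ^ i)"

definition q_fact :: "'a::field \<Rightarrow> nat \<Rightarrow> 'a" where
  "q_fact q k = (\<Prod>i=1..k. q_int q i)"

definition q_multinomial :: "'a::field \<Rightarrow> nat \<Rightarrow> nat list \<Rightarrow> 'a" where
  "q_multinomial q n as = q_fact q n / (\<Prod>a\<leftarrow>as. q_fact q a)"

text \<open>The indeterminate \<open>q\<close>, in the fraction field of the polynomial ring over the integers, so
  that the quotients of \<open>q\<close>-factorials are honest quotients.\<close>

definition q_var :: "int poly fract" where
  "q_var = Fract [:0, 1:] 1"

end

theory Submission
  imports Defs "HOL-Combinatorics.Multiset_Permutations"
begin

text \<open>
  An element of \<open>B_n\<close> is determined by the set \<open>S\<close> of absolute values it negates and by its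
  window, a word in the letters \<open>\<plusminus>b\<close> whose signs are prescribed by \<open>S\<close>. Of the two summands of
  \<open>dmaj\<close> and of the length, \<open>N2\<close> only depends on \<open>S\<close>: it is the sum of \<open>b - 1\<close> over \<open>b \<in> S\<close>.
  For fixed \<open>S\<close> the condition on the descents of the inverse says that certain values, adjacent
  in the sorted window, occur in increasing order. By MacMahon's theorem \<open>maj\<close> and \<open>inv\<close> have
  the same generating function on such a set of words, a \<open>q\<close>-multinomial coefficient.

  Summing over the admissible \<open>S\<close>, with weight \<open>s\<close> for every negation, the \<open>q\<close>-binomial theorem
  gives a product that vanishes for \<open>s = -1\<close>, so \<open>D_n\<close> contributes exactly half of the value at
  \<open>s = 1\<close>. The case \<open>0 \<notin> M\<close>, \<open>1 \<in> M\<close> reduces to \<open>0 \<in> M\<close>, \<open>1 \<notin> M\<close> by changing the sign of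
  the value \<open>1\<close>, which affects neither statistic.
\<close>

section \<open>Gaussian binomial coefficients\<close>

lemma q_int_0 [simp]: "q_int q 0 = 0"
  by (simp add: q_int_def)

lemma q_int_Suc: "q_int q (Suc k) = q_int q k + q ^ k"
  by (simp add: q_int_def)

lemma q_int_add: "q_int q (a + b) = q_int q a + q ^ a * q_int q b"
  by (induction b) (simp_all add: q_int_Suc algebra_simps power_add)

lemma q_fact_0 [simp]: "q_fact q 0 = 1"
  by (simp add: q_fact_def)

lemma q_fact_Suc: "q_fact q (Suc k) = q_int q (Suc k) * q_fact q k"
  by (simp add: q_fact_def mult.commute)

definition q_binomial :: "'q::field \<Rightarrow> nat \<Rightarrow> nat \<Rightarrow> 'q" where
  "q_binomial q n k = (if k \<le> n then q_fact q n / (q_fact q k * q_fact q (n - k)) else 0)"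

locale generic_q =
  fixes q :: "'q::field"
  assumes q_int_nonzero: "k > 0 \<Longrightarrow> q_int q k \<noteq> 0"
begin

lemma q_fact_nonzero: "q_fact q k \<noteq> 0"
  using q_int_nonzero by (simp add: q_fact_def)

lemma q_binomial_0 [simp]: "q_binomial q n 0 = 1"
  by (simp add: q_binomial_def q_fact_nonzero)

lemma q_binomial_Suc_Suc:
  assumes "k \<le> n"
  shows "q_binomial q (Suc n) (Suc k) = q_binomial q n (Suc k) + q ^ (n - k) * q_binomial q n k"
proof (cases "k = n")
  case True
  then show ?thesis
    by (simp add: q_binomial_def q_fact_nonzero)
next
  case False
  then obtain d where n_eq: "n = Suc (k + d)"
    using assms less_imp_Suc_add[of k n] by auto
  have "q_int q (Suc n) = q_int q (Suc d) + q ^ Suc d * q_int q (Suc k)"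
    using q_int_add[of q "Suc d" "Suc k"] by (simp add: n_eq ac_simps)
  moreover have "q_int q (Suc d) \<noteq> 0" "q_int q (Suc k) \<noteq> 0"
    by (simp_all add: q_int_nonzero)
  ultimately show ?thesis
    using q_fact_nonzero[of k] q_fact_nonzero[of d]
    by (simp add: q_binomial_def n_eq q_fact_Suc field_simps)
qed

theorem q_binomial_theorem:
  "(\<Prod>i<n. 1 + x * q ^ i) = (\<Sum>k\<le>n. q_binomial q n k * q ^ (k choose 2) * x ^ k)"
proof (induction n)
  case (Suc n)
  define c where "c k = q_binomial q n k * q ^ (k choose 2) * x ^ k" for k
  have "q_binomial q (Suc n) (Suc k) * q ^ (Suc k choose 2) * x ^ Suc k = c (Suc k) + x * q ^ n * c k"
    if "k \<le> n" for k
  proof -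
    have "q ^ (Suc k choose 2) = q ^ k * q ^ (k choose 2)"
      by (simp add: numeral_2_eq_2 power_add)
    moreover have "q ^ n = q ^ k * q ^ (n - k)"
      using that by (simp flip: power_add)
    ultimately show ?thesis
      using that by (simp add: c_def q_binomial_Suc_Suc algebra_simps)
  qed
  then have "(\<Sum>k\<le>Suc n. q_binomial q (Suc n) k * q ^ (k choose 2) * x ^ k) =
      c 0 + (\<Sum>k\<le>n. c (Suc k)) + x * q ^ n * (\<Sum>k\<le>n. c k)"
    unfolding sum.atMost_Suc_shift by (simp add: c_def sum.distrib sum_distrib_left binomial_eq_0)
  also have "c 0 + (\<Sum>k\<le>n. c (Suc k)) = (\<Sum>k\<le>n. c k)"
    unfolding sum.atMost_Suc_shift[symmetric] by (simp add: c_def q_binomial_def)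
  also have "(\<Sum>k\<le>n. c k) + x * q ^ n * (\<Sum>k\<le>n. c k) = (\<Prod>i<Suc n. 1 + x * q ^ i)"
    using Suc by (simp add: c_def algebra_simps)
  finally show ?case ..
qed (simp add: binomial_eq_0)

end

lemma generic_q_of_pos:
  fixes q :: "'q::linordered_field"
  assumes "q > 0"
  shows "generic_q q"
proof
  fix k :: nat assume "k > 0"
  with assms have "q_int q k > 0"
    unfolding q_int_def by (intro sum_pos) auto
  then show "q_int q k \<noteq> 0"
    by simp
qed

section \<open>MacMahon's theorem for words increasing on blocks\<close>

definition fiber :: "('a \<Rightarrow> 'b) \<Rightarrow> 'a set \<Rightarrow> 'b \<Rightarrow> 'a set" where
  "fiber f V k = {y \<in> V. f y = k}"

lemma mem_fiber [simp]: "y \<in> fiber f V k \<longleftrightarrow> y \<in> V \<and> f y = k"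
  by (simp add: fiber_def)

lemma finite_fiber [simp]: "finite V \<Longrightarrow> finite (fiber f V k)"
  by (simp add: fiber_def)

definition block_words :: "('a::linorder \<Rightarrow> 'b) \<Rightarrow> 'a set \<Rightarrow> 'a list set" where
  "block_words f V = {w \<in> permutations_of_set V. sorted_wrt (\<lambda>x y. f x = f y \<longrightarrow> x < y) w}"

definition block_max :: "('a::linorder \<Rightarrow> 'b) \<Rightarrow> 'a set \<Rightarrow> 'a set" where
  "block_max f V = {x \<in> V. \<forall>y\<in>V. f y = f x \<longrightarrow> y \<le> x}"

definition num_above :: "'a::linorder set \<Rightarrow> 'a \<Rightarrow> nat" where
  "num_above V x = card {y \<in> V. x < y}"

definition list_maj :: "'a::linorder list \<Rightarrow> nat" where
  "list_maj w = \<Sum>{i \<in> {1..<length w}. w ! (i - 1) > w ! i}"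

definition list_inv :: "'a::linorder list \<Rightarrow> nat" where
  "list_inv w = card {(i, j). i < j \<and> j < length w \<and> w ! i > w ! j}"

definition block_multinomial :: "'q::field \<Rightarrow> ('a \<Rightarrow> 'b) \<Rightarrow> 'a set \<Rightarrow> 'q" where
  "block_multinomial q f V = q_fact q (card V) / (\<Prod>k\<in>f ` V. q_fact q (card (fiber f V k)))"

lemma list_maj_Nil [simp]: "list_maj [] = 0"
  by (simp add: list_maj_def)

lemma list_inv_Nil [simp]: "list_inv [] = 0"
  by (simp add: list_inv_def)

lemma finite_block_words [simp]: "finite (block_words f V)"
  by (simp add: block_words_def)

lemma block_words_empty [simp]: "block_words f {} = {[]}"
  by (auto simp: block_words_def)

lemma length_block_words: "w \<in> block_words f V \<Longrightarrow> length w = card V"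
  by (simp add: block_words_def length_finite_permutations_of_set)

lemma block_max_subset: "block_max f V \<subseteq> V"
  by (auto simp: block_max_def)

lemma block_words_snoc:
  assumes "V \<noteq> {}"
  shows "block_words f V = (\<Union>x\<in>block_max f V. (\<lambda>w. w @ [x]) ` block_words f (V - {x}))"
proof (intro equalityI subsetI)
  fix w assume w: "w \<in> block_words f V"
  with assms have "w \<noteq> []"
    by (auto simp: block_words_def permutations_of_set_def)
  then obtain u x where "w = u @ [x]"
    by (metis rev_exhaust)
  with w have "x \<in> block_max f V" "u \<in> block_words f (V - {x})"
    by (auto simp: block_words_def permutations_of_set_def block_max_def sorted_wrt_append less_imp_le)
  with \<open>w = u @ [x]\<close> show "w \<in> (\<Union>x\<in>block_max f V. (\<lambda>w. w @ [x]) ` block_words f (V - {x}))"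
    by auto
next
  fix w assume "w \<in> (\<Union>x\<in>block_max f V. (\<lambda>w. w @ [x]) ` block_words f (V - {x}))"
  then show "w \<in> block_words f V"
    by (auto simp: block_words_def permutations_of_set_def block_max_def sorted_wrt_append
        order.strict_iff_order)
qed

lemma sum_block_words_snoc:
  assumes "finite V" "V \<noteq> {}"
  shows "(\<Sum>w\<in>block_words f V. g w) = (\<Sum>x\<in>block_max f V. \<Sum>w\<in>block_words f (V - {x}). g (w @ [x]))"
  unfolding block_words_snoc[OF assms(2), of f]
  using finite_subset[OF block_max_subset assms(1)]
  by (subst sum.UNION_disjoint) (auto simp: sum.reindex inj_on_def)

lemma list_maj_snoc:
  "list_maj (w @ [x]) = list_maj w + (if w \<noteq> [] \<and> last w > x then length w else 0)"
proof -
  have "{i \<in> {1..<length (w @ [x])}. (w @ [x]) ! (i - 1) > (w @ [x]) ! i} =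
      {i \<in> {1..<length w}. w ! (i - 1) > w ! i} \<union> (if w \<noteq> [] \<and> last w > x then {length w} else {})"
    by (cases w rule: rev_cases) (auto simp: nth_append less_Suc_eq)
  then show ?thesis
    by (simp add: list_maj_def)
qed

lemma list_inv_snoc:
  assumes "distinct w"
  shows "list_inv (w @ [x]) = list_inv w + num_above (set w) x"
proof -
  let ?A = "{(i, j). i < j \<and> j < length w \<and> w ! i > w ! j}"
  let ?B = "{i. i < length w \<and> w ! i > x}"
  have "{(i, j). i < j \<and> j < length (w @ [x]) \<and> (w @ [x]) ! i > (w @ [x]) ! j} = ?A \<union> ?B \<times> {length w}"
    by (auto simp: nth_append less_Suc_eq split: if_splits)
  moreover have "finite ?A"
    by (rule finite_subset[of _ "{..length w} \<times> {..length w}"]) auto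
  moreover have "?A \<inter> ?B \<times> {length w} = {}"
    by auto
  ultimately have "list_inv (w @ [x]) = list_inv w + card ?B"
    by (simp add: list_inv_def card_Un_disjoint card_cartesian_product)
  moreover have "bij_betw (\<lambda>i. w ! i) ?B {y \<in> set w. x < y}"
    using assms by (auto simp: bij_betw_def inj_on_def nth_eq_iff_index_eq in_set_conv_nth image_iff)
  ultimately show ?thesis
    by (simp add: num_above_def bij_betw_same_card)
qed

lemma list_maj_map:
  assumes "strict_mono_on (set w) h"
  shows "list_maj (map h w) = list_maj w"
  unfolding list_maj_def
  by (rule arg_cong[of _ _ Sum]) (auto simp: strict_mono_on_less[OF assms])

lemma list_inv_map:
  assumes "strict_mono_on (set w) h"
  shows "list_inv (map h w) = list_inv w"
  unfolding list_inv_def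
  by (rule arg_cong[of _ _ card]) (auto simp: strict_mono_on_less[OF assms])

lemma inj_on_block_max: "inj_on f (block_max f V)"
  by (auto simp: inj_on_def block_max_def intro: antisym)

lemma image_block_max:
  assumes "finite V"
  shows "f ` block_max f V = f ` V"
proof (intro equalityI subsetI)
  fix k assume "k \<in> f ` V"
  then have fiber: "fiber f V k \<noteq> {}" "finite (fiber f V k)"
    using assms by (auto simp: fiber_def)
  then have "Max (fiber f V k) \<in> fiber f V k"
    by (intro Max_in)
  moreover from this fiber have "Max (fiber f V k) \<in> block_max f V"
    by (auto simp: block_max_def)
  ultimately show "k \<in> f ` block_max f V"
    by force
qed (auto simp: block_max_def)

lemma block_max_less_iff:
  fixes f :: "'a::linorder \<Rightarrow> 'b::linorder"
  assumes "mono_on V f" "x \<in> block_max f V" "y \<in> V"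
  shows "x < y \<longleftrightarrow> f x < f y"
proof
  assume "x < y"
  with assms have "f x \<le> f y" "f x \<noteq> f y"
    by (auto simp: block_max_def monotone_on_def dest: less_imp_le)
  then show "f x < f y"
    by simp
next
  assume "f x < f y"
  then have "\<not> f y \<le> f x"
    by simp
  then show "x < y"
    using assms by (auto simp: block_max_def monotone_on_def not_le[symmetric])
qed

lemma sum_power_num_above:
  assumes "finite V"
  shows "(\<Sum>x\<in>V. q ^ num_above V x) = q_int q (card V)"
  using assms
proof (induction rule: finite_linorder_min_induct)
  case (insert b A)
  have "{y \<in> insert b A. b < y} = A"
    using insert by auto
  moreover have "{y \<in> insert b A. x < y} = {y \<in> A. x < y}" if "x \<in> A" for x
    using insert that by auto
  moreover have "b \<notin> A"
    using insert by auto
  ultimately show ?case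
    using insert by (simp add: num_above_def q_int_Suc)
qed simp

text \<open>\<open>last_weight q f V x / q_int q (card V)\<close> is the share of the words ending in \<open>x\<close> in the
  generating function of \<open>block_words f V\<close>, for \<open>maj\<close> and \<open>inv\<close> alike.\<close>

definition last_weight :: "'q::field \<Rightarrow> ('a::linorder \<Rightarrow> 'b) \<Rightarrow> 'a set \<Rightarrow> 'a \<Rightarrow> 'q" where
  "last_weight q f V x = q ^ num_above V x * q_int q (card (fiber f V (f x)))"

lemma last_weight_eq_sum:
  fixes f :: "'a::linorder \<Rightarrow> 'b::linorder"
  assumes "finite V" "mono_on V f" and x: "x \<in> block_max f V"
  shows "last_weight q f V x = (\<Sum>z\<in>fiber f V (f x). q ^ num_above V z)"
proof -
  let ?B = "fiber f V (f x)"
  have "num_above V z = num_above V x + num_above ?B z" if z: "z \<in> ?B" for z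
  proof -
    have "z \<le> x"
      using x z by (auto simp: block_max_def)
    have "f y = f x" if "y \<in> V" "z < y" "\<not> x < y" for y
    proof (rule antisym)
      show "f y \<le> f x"
        using block_max_less_iff[OF assms(2) x] that by auto
      show "f x \<le> f y"
        using z that assms(2) by (auto simp: monotone_on_def)
    qed
    with \<open>z \<le> x\<close> have "{y \<in> V. z < y} = {y \<in> V. x < y} \<union> {y \<in> ?B. z < y}"
      by auto
    moreover have "{y \<in> V. x < y} \<inter> {y \<in> ?B. z < y} = {}"
      using x by (auto simp: block_max_def)
    ultimately show ?thesis
      using assms(1) by (simp add: num_above_def card_Un_disjoint)
  qed
  then have "(\<Sum>z\<in>?B. q ^ num_above V z) = (\<Sum>z\<in>?B. q ^ num_above V x * q ^ num_above ?B z)"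
    by (intro sum.cong) (auto simp: power_add)
  also have "\<dots> = last_weight q f V x"
    using assms(1) by (simp add: last_weight_def sum_power_num_above flip: sum_distrib_left)
  finally show ?thesis ..
qed

lemma sum_last_weight:
  fixes f :: "'a::linorder \<Rightarrow> 'b::linorder"
  assumes "finite V" "mono_on V f"
  shows "(\<Sum>x\<in>block_max f V. last_weight q f V x) = q_int q (card V)"
proof -
  have "(\<Sum>x\<in>block_max f V. last_weight q f V x) =
      (\<Sum>x\<in>block_max f V. \<Sum>z\<in>fiber f V (f x). q ^ num_above V z)"
    using assms by (intro sum.cong refl last_weight_eq_sum)
  also have "\<dots> = (\<Sum>k\<in>f ` V. \<Sum>z\<in>fiber f V k. q ^ num_above V z)"
    by (simp add: sum.reindex[OF inj_on_block_max] o_def flip: image_block_max[OF assms(1)])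
  also have "\<dots> = (\<Sum>z\<in>V. q ^ num_above V z)"
    unfolding fiber_def using assms(1) by (intro sum.group) auto
  finally show ?thesis
    using sum_power_num_above[OF assms(1), of q] by simp
qed

lemma sum_last_weight_above:
  fixes f :: "'a::linorder \<Rightarrow> 'b::linorder"
  assumes "finite U" "mono_on U f"
    and unsplit: "\<And>y z. y \<in> U \<Longrightarrow> z \<in> U \<Longrightarrow> f y = f z \<Longrightarrow> x < y \<Longrightarrow> x < z"
  shows "(\<Sum>y | y \<in> block_max f U \<and> x < y. last_weight q f U y) = q_int q (num_above U x)"
proof -
  define H where "H = {y \<in> U. x < y}"
  have upper_closed: "z \<in> H" if "y \<in> H" "z \<in> U" "f z = f y" for y z
    using unsplit[of y z] that by (simp add: H_def)
  have "y \<in> block_max f U \<and> x < y \<longleftrightarrow> y \<in> block_max f H" for y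
    using upper_closed[of y] by (auto simp: block_max_def H_def)
  then have "{y. y \<in> block_max f U \<and> x < y} = block_max f H"
    by blast
  moreover have "last_weight q f U y = last_weight q f H y" if "y \<in> H" for y
  proof -
    have "{z \<in> U. y < z} = {z \<in> H. y < z}"
      using that by (auto simp: H_def)
    moreover have "fiber f U (f y) = fiber f H (f y)"
      using upper_closed[OF that] by (auto simp: H_def)
    ultimately show ?thesis
      by (simp add: last_weight_def num_above_def)
  qed
  moreover have "finite H" "mono_on H f"
    using assms by (auto simp: H_def monotone_on_def)
  ultimately show ?thesis
    using sum_last_weight[of H f q] block_max_subset[of f H]
    by (simp add: num_above_def H_def[symmetric] subset_iff)
qed

lemma sum_last_weight_penultimate:
  fixes f :: "'a::linorder \<Rightarrow> 'b::linorder"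
  assumes "finite U" "mono_on U f"
    and unsplit: "\<And>y z. y \<in> U \<Longrightarrow> z \<in> U \<Longrightarrow> f y = f z \<Longrightarrow> x < y \<Longrightarrow> x < z"
  shows "(\<Sum>y\<in>block_max f U. (if x < y then q ^ card U else 1) * last_weight q f U y) =
    q ^ num_above U x * q_int q (card U)"
proof -
  let ?W = "last_weight q f U" and ?h = "num_above U x"
  have fin: "finite (block_max f U)"
    using finite_subset[OF block_max_subset assms(1)] .
  have above: "(\<Sum>y\<in>block_max f U. if x < y then ?W y else 0) = q_int q ?h"
    using sum_last_weight_above[OF assms] by (simp add: sum.inter_filter[OF fin])
  have "(\<Sum>y\<in>block_max f U. (if x < y then q ^ card U else 1) * ?W y) =
      (\<Sum>y\<in>block_max f U. ?W y + q ^ card U * (if x < y then ?W y else 0) - (if x < y then ?W y else 0))"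
    by (intro sum.cong) auto
  also have "\<dots> = q_int q (card U) + q ^ card U * q_int q ?h - q_int q ?h"
    by (simp only: sum.distrib sum_subtractf sum_distrib_left[symmetric] above
        sum_last_weight[OF assms(1,2)])
  also have "\<dots> = q ^ ?h * q_int q (card U)"
    using q_int_add[of q "card U" ?h] q_int_add[of q ?h "card U"] by (simp add: add.commute)
  finally show ?thesis .
qed

lemma block_multinomial_eq_superset:
  assumes "finite K" "f ` V \<subseteq> K"
  shows "block_multinomial q f V = q_fact q (card V) / (\<Prod>k\<in>K. q_fact q (card (fiber f V k)))"
proof -
  have "fiber f V k = {}" if "k \<notin> f ` V" for k
    using that by auto
  then have "(\<Prod>k\<in>f ` V. q_fact q (card (fiber f V k))) = (\<Prod>k\<in>K. q_fact q (card (fiber f V k)))"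
    using assms by (intro prod.mono_neutral_left) auto
  then show ?thesis
    by (simp add: block_multinomial_def)
qed

text \<open>For \<open>maj\<close> the sum over the words with a fixed last letter satisfies a closed recursion: the
  penultimate letter alone decides whether the last position is a descent.\<close>

lemma sum_list_maj_penultimate:
  fixes q :: "'q::comm_semiring_1"
  assumes "finite U" "U \<noteq> {}"
  shows "(\<Sum>w\<in>block_words f U. q ^ list_maj (w @ [x])) =
    (\<Sum>y\<in>block_max f U. (if x < y then q ^ card U else 1) *
      (\<Sum>w\<in>block_words f (U - {y}). q ^ list_maj (w @ [y])))"
  unfolding sum_block_words_snoc[OF assms] sum_distrib_left
proof (intro sum.cong refl)
  fix y w assume "y \<in> block_max f U" "w \<in> block_words f (U - {y})"
  then have "Suc (length w) = card U"
    using assms(1) block_max_subset[of f U] card.remove[of U y] by (auto dest!: length_block_words)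
  then show "q ^ list_maj ((w @ [y]) @ [x]) = (if x < y then q ^ card U else 1) * q ^ list_maj (w @ [y])"
    unfolding list_maj_snoc[of "w @ [y]"] by (simp add: power_add mult.commute)
qed

context generic_q
begin

lemma block_multinomial_remove:
  assumes "finite V" "x \<in> V"
  shows "q_int q (card V) * block_multinomial q f (V - {x}) =
    q_int q (card (fiber f V (f x))) * block_multinomial q f V"
proof -
  let ?B = "fiber f V (f x)"
  obtain v b where card: "card V = Suc v" "card (V - {x}) = v" "card ?B = Suc b" "card (?B - {x}) = b"
    using assms by (metis card.remove finite_fiber mem_fiber)
  have "fiber f (V - {x}) (f x) = ?B - {x}"
    and "\<And>k. k \<noteq> f x \<Longrightarrow> fiber f (V - {x}) k = fiber f V k"
    by auto
  then have "block_multinomial q f (V - {x}) = q_fact q (card (V - {x})) /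
      (q_fact q (card (?B - {x})) * (\<Prod>k\<in>f ` V - {f x}. q_fact q (card (fiber f V k))))"
    using assms by (subst block_multinomial_eq_superset[of "f ` V"])
      (auto simp: prod.remove[of "f ` V" "f x"])
  moreover have "block_multinomial q f V = q_fact q (card V) /
      (q_fact q (card ?B) * (\<Prod>k\<in>f ` V - {f x}. q_fact q (card (fiber f V k))))"
    using assms by (simp add: block_multinomial_def prod.remove[of "f ` V" "f x"])
  ultimately show ?thesis
    using q_int_nonzero[of "card ?B"] by (simp add: card q_fact_Suc)
qed

lemma sum_block_words_by_last:
  fixes f :: "'a::linorder \<Rightarrow> 'b::linorder"
  assumes "finite V" "mono_on V f" "g [] = 0"
    and "\<And>x. x \<in> block_max f V \<Longrightarrow> (\<Sum>w\<in>block_words f (V - {x}). q ^ g (w @ [x])) =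
      q ^ num_above V x * block_multinomial q f (V - {x})"
  shows "(\<Sum>w\<in>block_words f V. q ^ g w) = block_multinomial q f V"
proof (cases "V = {}")
  case True
  then show ?thesis
    by (simp add: assms(3) block_multinomial_def)
next
  case False
  have "q_int q (card V) * (\<Sum>w\<in>block_words f V. q ^ g w) =
      (\<Sum>x\<in>block_max f V. q ^ num_above V x * (q_int q (card V) * block_multinomial q f (V - {x})))"
    by (simp add: sum_block_words_snoc[OF assms(1) False] assms(4) sum_distrib_left mult.left_commute)
  also have "\<dots> = (\<Sum>x\<in>block_max f V. last_weight q f V x) * block_multinomial q f V"
    unfolding sum_distrib_right
    by (intro sum.cong refl)
      (simp add: block_multinomial_remove[OF assms(1)] last_weight_def subsetD[OF block_max_subset]
        mult.assoc)
  finally show ?thesis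
    using q_int_nonzero[of "card V"] False assms(1)
    by (simp add: sum_last_weight[OF assms(1,2)] card_gt_0_iff)
qed

theorem sum_list_inv_block_words:
  fixes f :: "'a::linorder \<Rightarrow> 'b::linorder"
  assumes "finite V" "mono_on V f"
  shows "(\<Sum>w\<in>block_words f V. q ^ list_inv w) = block_multinomial q f V"
  using assms
proof (induction V rule: finite_psubset_induct)
  case (psubset V)
  show ?case
  proof (rule sum_block_words_by_last[where g = list_inv, OF psubset.hyps psubset.prems list_inv_Nil])
    fix x assume "x \<in> block_max f V"
    then have x: "V - {x} \<subset> V" "mono_on (V - {x}) f"
      using psubset.prems by (auto simp: block_max_def monotone_on_def)
    have "list_inv (w @ [x]) = num_above V x + list_inv w" if "w \<in> block_words f (V - {x})" for w
    proof -
      have "set w = V - {x}" "distinct w"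
        using that by (auto simp: block_words_def permutations_of_set_def)
      moreover have "{y \<in> V - {x}. x < y} = {y \<in> V. x < y}"
        by auto
      ultimately show ?thesis
        by (simp add: list_inv_snoc num_above_def)
    qed
    then show "(\<Sum>w\<in>block_words f (V - {x}). q ^ list_inv (w @ [x])) =
        q ^ num_above V x * block_multinomial q f (V - {x})"
      using psubset.IH[OF x] by (simp add: power_add flip: sum_distrib_left)
  qed
qed

lemma sum_list_maj_last:
  fixes f :: "'a::linorder \<Rightarrow> 'b::linorder"
  assumes "finite V" "mono_on V f" "x \<in> block_max f V"
  shows "(\<Sum>w\<in>block_words f (V - {x}). q ^ list_maj (w @ [x])) =
    q ^ num_above V x * block_multinomial q f (V - {x})"
  using assms
proof (induction V arbitrary: x rule: finite_psubset_induct)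
  case (psubset V)
  define U where "U = V - {x}"
  have rest: "finite U" "mono_on U f" "U \<subset> V"
    using psubset by (auto simp: U_def block_max_def monotone_on_def)
  have "{y \<in> V. x < y} = {y \<in> U. x < y}"
    by (auto simp: U_def)
  then have above: "num_above V x = num_above U x"
    by (simp add: num_above_def)
  show ?case
  proof (cases "U = {}")
    case True
    then show ?thesis
      using above by (simp add: U_def[symmetric] list_maj_def block_multinomial_def num_above_def)
  next
    case False
    let ?d = "\<lambda>y. if x < y then q ^ card U else 1"
    have unsplit: "x < z" if "y \<in> U" "z \<in> U" "f y = f z" "x < y" for y z
      using block_max_less_iff[OF psubset.prems] that by (auto simp: U_def)
    have "q_int q (card U) * (\<Sum>w\<in>block_words f U. q ^ list_maj (w @ [x])) =
        (\<Sum>y\<in>block_max f U. ?d y *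
          (q ^ num_above U y * (q_int q (card U) * block_multinomial q f (U - {y}))))"
      by (simp add: sum_list_maj_penultimate[OF rest(1) False] psubset.IH[OF rest(3,2)]
          sum_distrib_left ac_simps)
    also have "\<dots> = (\<Sum>y\<in>block_max f U. ?d y * last_weight q f U y) * block_multinomial q f U"
      unfolding sum_distrib_right
      by (intro sum.cong refl)
        (simp add: block_multinomial_remove[OF rest(1)] last_weight_def subsetD[OF block_max_subset]
          mult.assoc)
    also have "\<dots> = q_int q (card U) * (q ^ num_above V x * block_multinomial q f U)"
      using sum_last_weight_penultimate[where x = x and q = q, OF rest(1,2) unsplit] above by simp
    finally show ?thesis
      using q_int_nonzero[of "card U"] False rest(1) by (simp add: card_gt_0_iff flip: U_def)
  qed
qed

theorem sum_list_maj_block_words: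
  fixes f :: "'a::linorder \<Rightarrow> 'b::linorder"
  assumes "finite V" "mono_on V f"
  shows "(\<Sum>w\<in>block_words f V. q ^ list_maj w) = block_multinomial q f V"
  using assms by (intro sum_block_words_by_last sum_list_maj_last list_maj_Nil)

end

section \<open>Sums over sets split by a disjoint family\<close>

lemma Int_UN_disjoint_family:
  assumes "disjoint_family_on A I" "\<And>j. j \<in> I \<Longrightarrow> g j \<subseteq> A j" "i \<in> I"
  shows "(\<Union>j\<in>I. g j) \<inter> A i = g i"
proof -
  have "A i \<inter> A j = {}" if "j \<in> I" "j \<noteq> i" for j
    using assms(1,3) that by (auto simp: disjoint_family_on_def)
  with assms(2,3) show ?thesis
    by blast
qed

lemma sum_prod_Int_disjoint_family:
  fixes \<phi> :: "'i \<Rightarrow> 'a set \<Rightarrow> 'q::comm_semiring_1"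
  assumes "finite I" "disjoint_family_on A I"
    and "\<And>i. i \<in> I \<Longrightarrow> finite (A i)" "\<And>i. i \<in> I \<Longrightarrow> F i \<subseteq> Pow (A i)"
  shows "(\<Sum>S | S \<subseteq> (\<Union>i\<in>I. A i) \<and> (\<forall>i\<in>I. S \<inter> A i \<in> F i). \<Prod>i\<in>I. \<phi> i (S \<inter> A i)) =
    (\<Prod>i\<in>I. \<Sum>T\<in>F i. \<phi> i T)"
proof -
  have inter: "(\<Union>j\<in>I. g j) \<inter> A i = g i" if "g \<in> Pi\<^sub>E I F" "i \<in> I" for g i
    using that assms(4) by (intro Int_UN_disjoint_family[OF assms(2)]) (auto simp: PiE_def Pi_def)
  have "finite (F i)" if "i \<in> I" for i
    using assms(3,4)[OF that] by (meson finite_Pow_iff finite_subset)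
  then have "(\<Prod>i\<in>I. \<Sum>T\<in>F i. \<phi> i T) = (\<Sum>g\<in>Pi\<^sub>E I F. \<Prod>i\<in>I. \<phi> i (g i))"
    by (intro prod_sum_PiE assms(1))
  also have "\<dots> = (\<Sum>S | S \<subseteq> (\<Union>i\<in>I. A i) \<and> (\<forall>i\<in>I. S \<inter> A i \<in> F i). \<Prod>i\<in>I. \<phi> i (S \<inter> A i))"
  proof (rule sum.reindex_bij_witness[of _ "\<lambda>S. \<lambda>i\<in>I. S \<inter> A i" "\<lambda>g. \<Union>i\<in>I. g i"])
    fix g assume g: "g \<in> Pi\<^sub>E I F"
    show "(\<lambda>i\<in>I. (\<Union>j\<in>I. g j) \<inter> A i) = g"
      using g by (intro ext) (auto simp: inter PiE_def extensional_def restrict_def)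
    show "(\<Union>i\<in>I. g i) \<in> {S. S \<subseteq> (\<Union>i\<in>I. A i) \<and> (\<forall>i\<in>I. S \<inter> A i \<in> F i)}"
      using g inter[OF g] assms(4) by (auto simp: PiE_def Pi_def)
    show "(\<Prod>i\<in>I. \<phi> i ((\<Union>i\<in>I. g i) \<inter> A i)) = (\<Prod>i\<in>I. \<phi> i (g i))"
      using inter[OF g] by simp
  qed auto
  finally show ?thesis ..
qed

lemma two_mult_sum_parity:
  fixes G :: "'a \<Rightarrow> 'q::comm_ring_1"
  assumes "finite A" "(\<Sum>x\<in>A. (- 1) ^ c x * G x) = 0"
  shows "2 * (\<Sum>x | x \<in> A \<and> (even (c x) \<longleftrightarrow> e). G x) = (\<Sum>x\<in>A. G x)"
proof -
  have "2 * (\<Sum>x | x \<in> A \<and> (even (c x) \<longleftrightarrow> e). G x) =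
      (\<Sum>x\<in>A. G x + (if e then 1 else - 1) * ((- 1) ^ c x * G x))"
    unfolding sum.inter_filter[OF assms(1)] sum_distrib_left by (intro sum.cong) auto
  also have "\<dots> = (\<Sum>x\<in>A. G x)"
    unfolding sum.distrib sum_distrib_left[symmetric] assms(2) by simp
  finally show ?thesis .
qed

definition down_sets :: "'a::linorder set \<Rightarrow> 'a set set" where
  "down_sets A = {T. T \<subseteq> A \<and> (\<forall>u\<in>A. \<forall>v\<in>T. u < v \<longrightarrow> u \<in> T)}"

lemma down_sets_interval: "down_sets {c<..d} = (\<lambda>k. {c<..c + k}) ` {..d - c}" for c d :: nat
proof (intro equalityI subsetI)
  fix T assume down: "T \<in> down_sets {c<..d}"
  show "T \<in> (\<lambda>k. {c<..c + k}) ` {..d - c}"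
  proof (cases "T = {}")
    case True
    then show ?thesis
      by (intro image_eqI[of _ _ 0]) auto
  next
    case False
    have T_subset: "T \<subseteq> {c<..d}"
      using down by (simp add: down_sets_def)
    then have max: "Max T \<in> T" "\<And>u. u \<in> T \<Longrightarrow> u \<le> Max T"
      using False finite_subset[of T] by auto
    have Max_bounds: "c < Max T" "Max T \<le> d"
      using max(1) T_subset by auto
    have "u \<in> T" if "u \<in> {c<..Max T}" for u
    proof -
      have "u = Max T \<or> u < Max T \<and> u \<in> {c<..d}"
        using that Max_bounds by auto
      then show ?thesis
        using down max(1) by (auto simp: down_sets_def)
    qed
    then have "T = {c<..Max T}"
      using T_subset max(2) by auto
    with Max_bounds show ?thesis
      by (intro image_eqI[of _ _ "Max T - c"]) auto
  qed
qed (auto simp: down_sets_def)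

lemma sum_pred_greaterThanAtMost: "(\<Sum>b\<in>{c<..c + k}. b - 1) = k * c + (k choose 2)"
proof (induction k)
  case (Suc k)
  have "{c<..c + Suc k} = insert (c + Suc k) {c<..c + k}"
    by auto
  with Suc show ?case
    by (simp add: numeral_2_eq_2)
qed (simp add: binomial_eq_0)

lemma (in generic_q) sum_down_sets_interval:
  "(\<Sum>T\<in>down_sets {c<..d}. s ^ card T * q ^ (\<Sum>b\<in>T. b - 1) /
      (q_fact q (card T) * q_fact q (card ({c<..d} - T)))) =
    (\<Prod>i=c..<d. 1 + s * q ^ i) / q_fact q (d - c)"
proof -
  have inj: "inj_on (\<lambda>k. {c<..c + k}) {..d - c}"
    by (rule inj_on_inverseI[of _ card]) simp
  have summand: "s ^ k * q ^ (k * c + (k choose 2)) /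
        (q_fact q k * q_fact q (card ({c<..d} - {c<..c + k}))) =
      q_binomial q (d - c) k * q ^ (k choose 2) * (s * q ^ c) ^ k / q_fact q (d - c)"
    if "k \<le> d - c" for k
  proof -
    have "card ({c<..d} - {c<..c + k}) = d - c - k"
      using that by (subst card_Diff_subset) auto
    then show ?thesis
      using that q_fact_nonzero[of "d - c"]
      by (simp add: q_binomial_def power_add power_mult_distrib mult.commute[of k c] flip: power_mult)
  qed
  have "(\<Sum>k\<le>d - c. q_binomial q (d - c) k * q ^ (k choose 2) * (s * q ^ c) ^ k) =
      (\<Prod>i<d - c. 1 + s * q ^ (c + i))"
    using q_binomial_theorem[of "s * q ^ c" "d - c"] by (simp add: power_add mult.assoc)
  also have "\<dots> = (\<Prod>i=c..<d. 1 + s * q ^ i)"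
    by (rule prod.reindex_bij_witness[of _ "\<lambda>i. i - c" "\<lambda>i. c + i"]) auto
  finally show ?thesis
    by (simp add: down_sets_interval sum.reindex[OF inj] sum_pred_greaterThanAtMost summand
        del: One_nat_def flip: sum_divide_distrib)
qed

section \<open>Signed values and their blocks\<close>

definition signed :: "nat set \<Rightarrow> nat \<Rightarrow> int" where
  "signed S b = (if b \<in> S then - int b else int b)"

definition signed_values :: "nat \<Rightarrow> nat set \<Rightarrow> int set" where
  "signed_values n S = signed S ` {1..n}"

lemma abs_signed [simp]: "\<bar>signed S b\<bar> = int b"
  by (simp add: signed_def)

lemma inj_on_signed: "inj_on (signed S) A"
  by (rule inj_on_inverseI[of _ "\<lambda>x. nat \<bar>x\<bar>"]) simp

lemma finite_signed_values [simp]: "finite (signed_values n S)"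
  by (simp add: signed_values_def)

lemma card_signed_values [simp]: "card (signed_values n S) = n"
  by (simp add: signed_values_def card_image inj_on_signed)

lemma prod_symmetric_interval:
  "(\<Prod>k\<in>{- int t..int t}. h k) = h 0 * (\<Prod>j=1..t. h (int j) * h (- int j))"
proof (induction t)
  case (Suc t)
  have "{- int (Suc t)..int (Suc t)} = insert (int (Suc t)) (insert (- int (Suc t)) {- int t..int t})"
    by auto
  with Suc show ?case
    by (simp add: ac_simps)
qed simp

lemma q_multinomial_map_upt:
  "q_multinomial q n (map f [0..<Suc t]) = q_fact q n / (\<Prod>j\<le>t. q_fact q (f j))"
proof -
  have "(\<Prod>j\<leftarrow>[0..<Suc t]. q_fact q (f j)) = (\<Prod>j\<in>set [0..<Suc t]. q_fact q (f j))"
    by (rule prod.distinct_set_conv_list[symmetric]) simp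
  also have "set [0..<Suc t] = {..t}"
    by auto
  finally show ?thesis
    by (simp add: q_multinomial_def o_def del: upt_Suc)
qed

locale block_partition =
  fixes n t :: nat and \<mu> :: "nat \<Rightarrow> nat"
  assumes first: "\<mu> 0 = 0"
    and step: "j \<le> t \<Longrightarrow> \<mu> j \<le> \<mu> (Suc j)"
    and final: "\<mu> (Suc t) = n"
begin

definition block :: "nat \<Rightarrow> nat set" where
  "block j = {\<mu> j<..\<mu> (Suc j)}"

definition block_sizes :: "nat list" where
  "block_sizes = map (\<lambda>j. \<mu> (Suc j) - \<mu> j) [0..<Suc t]"

text \<open>A difference of two counts, so that the label is visibly monotone; its value at \<open>\<plusminus>b\<close> is \<open>\<plusminus>j\<close>
  for \<open>b \<in> block j\<close>.\<close>

definition signed_label :: "int \<Rightarrow> int" where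
  "signed_label x = int (card {j \<in> {1..t}. int (\<mu> j) < x}) - int (card {j \<in> {1..t}. int (\<mu> j) < - x})"

text \<open>The first block is the one governed by the type D condition at \<open>0\<close>.\<close>

definition block_negations :: "nat \<Rightarrow> nat set set" where
  "block_negations j = (if j = 0 then Pow ({1} \<inter> block 0) else down_sets (block j))"

definition negations :: "nat set set" where
  "negations = {S. S \<subseteq> {1..n} \<and> (\<forall>j\<le>t. S \<inter> block j \<in> block_negations j)}"

lemma boundary_mono: "i \<le> j \<Longrightarrow> j \<le> Suc t \<Longrightarrow> \<mu> i \<le> \<mu> j"
  by (rule lift_Suc_mono_le_ivl[of "{..t}"]) (auto intro: step)

lemma finite_block [simp]: "finite (block j)"
  by (simp add: block_def)

lemma card_block: "card (block j) = \<mu> (Suc j) - \<mu> j"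
  by (simp add: block_def)

lemma block_0: "block 0 = {1..\<mu> 1}"
  by (auto simp: block_def first)

lemma UN_block_lessThan: "k \<le> Suc t \<Longrightarrow> (\<Union>j<k. block j) = {0<..\<mu> k}"
proof (induction k)
  case (Suc k)
  then have "\<mu> k \<le> \<mu> (Suc k)"
    by (simp add: step)
  then have "{0<..\<mu> k} \<union> block k = {0<..\<mu> (Suc k)}"
    by (auto simp: block_def)
  with Suc show ?case
    by (simp add: lessThan_Suc Un_commute)
qed (simp add: first)

lemma UN_block: "(\<Union>j\<le>t. block j) = {1..n}"
  using UN_block_lessThan[of "Suc t"] by (auto simp: lessThan_Suc_atMost final)

lemma block_subset: "j \<le> t \<Longrightarrow> block j \<subseteq> {1..n}"
  using UN_block by blast

lemma disjoint_blocks: "disjoint_family_on block {..t}"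
proof -
  have "block i \<inter> block j = {}" if "i < j" "j \<le> t" for i j
    using boundary_mono[of "Suc i" j] that by (auto simp: block_def)
  then show ?thesis
    unfolding disjoint_family_on_def by (metis atMost_iff inf_commute linorder_neqE_nat)
qed

lemma finite_negations [simp]: "finite negations"
  by (rule finite_subset[of _ "Pow {1..n}"]) (auto simp: negations_def)

lemma mono_signed_label: "mono signed_label"
proof
  fix x y :: int assume "x \<le> y"
  then have "card {j \<in> {1..t}. int (\<mu> j) < x} \<le> card {j \<in> {1..t}. int (\<mu> j) < y}"
    and "card {j \<in> {1..t}. int (\<mu> j) < - y} \<le> card {j \<in> {1..t}. int (\<mu> j) < - x}"
    by (auto intro!: card_mono)
  then show "signed_label x \<le> signed_label y"
    by (simp add: signed_label_def)
qed

lemma signed_label_signed: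
  assumes "j \<le> t" "b \<in> block j"
  shows "signed_label (signed S b) = (if b \<in> S then - int j else int j)"
proof -
  have "\<mu> i < b \<longleftrightarrow> i \<le> j" if "1 \<le> i" "i \<le> t" for i
  proof
    show "\<mu> i < b" if "i \<le> j"
      using boundary_mono[of i j] assms that by (auto simp: block_def)
    show "i \<le> j" if "\<mu> i < b"
      using boundary_mono[of "Suc j" i] assms that \<open>i \<le> t\<close>
      by (force simp: block_def not_less_eq_eq[symmetric])
  qed
  then have "{i \<in> {1..t}. int (\<mu> i) < int b} = {1..j}"
    using assms(1) by auto
  moreover have "{i \<in> {1..t}. int (\<mu> i) < - int b} = {}"
    by auto
  ultimately show ?thesis
    by (simp add: signed_label_def signed_def)
qed

lemma fiber_signed_label:
  "fiber signed_label (signed_values n S) k =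
    (\<Union>j\<le>t. signed S ` {b \<in> block j. (if b \<in> S then - int j else int j) = k})"
proof -
  have "fiber signed_label (signed_values n S) k =
      (\<Union>j\<le>t. signed S ` {b \<in> block j. signed_label (signed S b) = k})"
    unfolding fiber_def signed_values_def UN_block[symmetric] by auto
  then show ?thesis
    by (simp add: signed_label_signed cong: conj_cong)
qed

lemma fiber_signed_label_0: "fiber signed_label (signed_values n S) 0 = signed S ` block 0"
  by (auto simp: fiber_signed_label split: if_splits)

lemma fiber_signed_label_pos:
  assumes "j \<in> {1..t}"
  shows "fiber signed_label (signed_values n S) (int j) = int ` (block j - S)"
  using assms by (force simp: fiber_signed_label signed_def split: if_splits)

lemma fiber_signed_label_neg:
  assumes "j \<in> {1..t}"
  shows "fiber signed_label (signed_values n S) (- int j) = (\<lambda>b. - int b) ` (block j \<inter> S)"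
  using assms by (force simp: fiber_signed_label signed_def split: if_splits)

lemma signed_label_image_subset: "signed_label ` signed_values n S \<subseteq> {- int t..int t}"
  unfolding signed_values_def UN_block[symmetric] by (auto simp: signed_label_signed)

lemma block_multinomial_signed_values:
  "block_multinomial q signed_label (signed_values n S) =
    q_fact q n / (q_fact q (\<mu> 1) *
      (\<Prod>j=1..t. q_fact q (card (block j \<inter> S)) * q_fact q (card (block j - S))))"
proof -
  have card_fiber: "card (fiber signed_label (signed_values n S) 0) = \<mu> 1"
    "\<And>j. j \<in> {1..t} \<Longrightarrow> card (fiber signed_label (signed_values n S) (int j)) = card (block j - S)"
    "\<And>j. j \<in> {1..t} \<Longrightarrow> card (fiber signed_label (signed_values n S) (- int j)) = card (block j \<inter> S)"
    by (simp_all only: fiber_signed_label_0 fiber_signed_label_pos fiber_signed_label_neg)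
      (simp_all add: card_image[OF inj_on_signed] card_image inj_on_def block_0)
  have "block_multinomial q signed_label (signed_values n S) =
      q_fact q n / (\<Prod>k\<in>{- int t..int t}. q_fact q (card (fiber signed_label (signed_values n S) k)))"
    by (simp add: block_multinomial_eq_superset[OF _ signed_label_image_subset])
  also have "\<dots> = q_fact q n / (q_fact q (\<mu> 1) *
      (\<Prod>j=1..t. q_fact q (card (block j - S)) * q_fact q (card (block j \<inter> S))))"
    unfolding prod_symmetric_interval card_fiber(1) by (simp only: card_fiber(2,3) cong: prod.cong)
  finally show ?thesis
    by (simp only: mult.commute)
qed

lemma block_negations_subset: "block_negations j \<subseteq> Pow (block j)"
  by (auto simp: block_negations_def down_sets_def)

lemma prod_concat_blocks:
  fixes g :: "nat \<Rightarrow> 'q::comm_monoid_mult"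
  shows "(\<Prod>j=1..t. \<Prod>i=\<mu> j..<\<mu> (Suc j). g i) = (\<Prod>i=\<mu> 1..<n. g i)"
proof -
  have "k \<le> t \<Longrightarrow> (\<Prod>j=1..k. \<Prod>i=\<mu> j..<\<mu> (Suc j). g i) = (\<Prod>i=\<mu> 1..<\<mu> (Suc k). g i)" for k
  proof (induction k)
    case (Suc k)
    then show ?case
      using prod.atLeastLessThan_concat[OF boundary_mono[of 1 "Suc k"] step[of "Suc k"], of g] by simp
  qed simp
  from this[of t] show ?thesis
    by (simp add: final)
qed

end

locale q_block_partition = block_partition n t \<mu> + generic_q q
  for n t :: nat and \<mu> :: "nat \<Rightarrow> nat" and q :: "'q::field"
begin

definition block_weight :: "'q \<Rightarrow> nat \<Rightarrow> nat set \<Rightarrow> 'q" where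
  "block_weight s j T = s ^ card T * q ^ (\<Sum>b\<in>T. b - 1) /
    (if j = 0 then q_fact q (\<mu> 1) else q_fact q (card T) * q_fact q (card (block j - T)))"

definition negation_weight :: "nat set \<Rightarrow> 'q" where
  "negation_weight S = q ^ (\<Sum>b\<in>S. b - 1) * block_multinomial q signed_label (signed_values n S)"

lemma prod_block_weight:
  assumes "S \<subseteq> {1..n}"
  shows "s ^ card S * negation_weight S = q_fact q n * (\<Prod>j\<le>t. block_weight s j (S \<inter> block j))"
proof -
  have S_eq: "S = (\<Union>j\<le>t. S \<inter> block j)"
    using assms UN_block by blast
  have disjoint: "\<forall>i\<in>{..t}. \<forall>j\<in>{..t}. i \<noteq> j \<longrightarrow> (S \<inter> block i) \<inter> (S \<inter> block j) = {}"
    using disjoint_blocks by (auto simp: disjoint_family_on_def)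
  have "card S = (\<Sum>j\<le>t. card (S \<inter> block j))"
    by (subst S_eq, rule card_UN_disjoint) (use disjoint in auto)
  moreover have "(\<Sum>b\<in>S. b - 1) = (\<Sum>j\<le>t. \<Sum>b\<in>S \<inter> block j. b - 1)"
    by (subst S_eq, rule sum.UNION_disjoint) (use disjoint in auto)
  moreover have "{..t} = insert 0 {1..t}"
    by auto
  moreover have "block j \<inter> S = S \<inter> block j" "block j - S \<inter> block j = block j - S" for j
    by auto
  ultimately show ?thesis
    unfolding negation_weight_def block_multinomial_signed_values
    by (simp add: power_sum block_weight_def prod_dividef prod.distrib power_add)
qed

lemma sum_block_weight:
  "(\<Sum>T\<in>block_negations j. block_weight s j T) =
    (if j = 0 then if \<mu> 1 = 0 then 1 else 1 + s else \<Prod>i=\<mu> j..<\<mu> (Suc j). 1 + s * q ^ i) /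
      q_fact q (card (block j))"
proof (cases "j = 0")
  case True
  have "block_negations 0 = (if \<mu> 1 = 0 then {{}} else {{}, {1}})"
    by (auto simp: block_negations_def block_0)
  then show ?thesis
    using True by (simp add: block_weight_def card_block first add_divide_distrib)
next
  case False
  then show ?thesis
    using sum_down_sets_interval[of s "\<mu> j" "\<mu> (Suc j)"]
    by (simp add: block_negations_def block_weight_def card_block flip: block_def)
qed

theorem sum_negations:
  assumes "n \<ge> 1"
  shows "(\<Sum>S\<in>negations. s ^ card S * negation_weight S) =
    q_multinomial q n block_sizes * ((1 + s) * (\<Prod>i=max 1 (\<mu> 1)..<n. 1 + s * q ^ i))"
proof -
  have split_first: "{..t} = insert 0 {1..t}"
    by auto
  have "(\<Sum>S\<in>negations. s ^ card S * negation_weight S) =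
      q_fact q n * (\<Sum>S\<in>negations. \<Prod>j\<le>t. block_weight s j (S \<inter> block j))"
    unfolding sum_distrib_left by (intro sum.cong refl prod_block_weight) (simp add: negations_def)
  also have "(\<Sum>S\<in>negations. \<Prod>j\<le>t. block_weight s j (S \<inter> block j)) =
      (\<Prod>j\<le>t. \<Sum>T\<in>block_negations j. block_weight s j T)"
    using sum_prod_Int_disjoint_family[OF _ disjoint_blocks finite_block block_negations_subset]
    by (simp add: negations_def UN_block Ball_def)
  also have "\<dots> = (if \<mu> 1 = 0 then 1 else 1 + s) * (\<Prod>i=\<mu> 1..<n. 1 + s * q ^ i) /
      (\<Prod>j\<le>t. q_fact q (\<mu> (Suc j) - \<mu> j))"
    unfolding sum_block_weight prod_dividef card_block split_first
    by (simp del: One_nat_def add: prod_concat_blocks)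
  also have "(if \<mu> 1 = 0 then 1 else 1 + s) * (\<Prod>i=\<mu> 1..<n. 1 + s * q ^ i) =
      (1 + s) * (\<Prod>i=max 1 (\<mu> 1)..<n. 1 + s * q ^ i)"
    using assms by (cases "\<mu> 1 = 0") (simp_all add: prod.atLeast_Suc_lessThan[of 0 n] max_def)
  finally show ?thesis
    by (simp add: block_sizes_def q_multinomial_map_upt del: upt_Suc)
qed

corollary sum_negations_parity:
  assumes "n \<ge> 1" and two: "(2::'q) \<noteq> 0"
  shows "(\<Sum>S | S \<in> negations \<and> (even (card S) \<longleftrightarrow> e). negation_weight S) =
    q_multinomial q n block_sizes * (\<Prod>i=max 1 (\<mu> 1)..<n. 1 + q ^ i)"
    (is "?L = ?R")
proof -
  have "2 * ?L = (\<Sum>S\<in>negations. negation_weight S)"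
    using sum_negations[OF assms(1), of "- 1"]
    by (intro two_mult_sum_parity finite_negations) (simp add: mult.assoc)
  also have "\<dots> = 2 * ?R"
    using sum_negations[OF assms(1), of 1] by simp
  finally show ?thesis
    using two by simp
qed

end

section \<open>Windows of signed permutations\<close>

lemma finite_B_group: "finite (B_group n)"
  by (rule finite_subset[OF _ finite_permutations[of "{- int n..int n} - {0}"]])
    (auto simp: B_group_def)

lemma B_group_bij: "\<beta> \<in> B_group n \<Longrightarrow> bij \<beta>"
  by (auto simp: B_group_def permutes_bij)

lemma B_group_outside: "\<beta> \<in> B_group n \<Longrightarrow> i \<notin> {- int n..int n} - {0} \<Longrightarrow> \<beta> i = i"
  using permutes_not_in[of \<beta> "{- int n..int n} - {0}" i] by (simp add: B_group_def)

lemma B_group_odd: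
  assumes "\<beta> \<in> B_group n"
  shows "\<beta> (- i) = - \<beta> i"
proof (cases "i \<in> {- int n..int n} - {0}")
  case False
  then have "- i \<notin> {- int n..int n} - {0}"
    by auto
  with False have "\<beta> (- i) = - i" "\<beta> i = i"
    using B_group_outside[OF assms] by blast+
  then show ?thesis
    by simp
qed (use assms in \<open>auto simp: B_group_def\<close>)

lemma B_group_abs_mem_iff:
  assumes "\<beta> \<in> B_group n"
  shows "\<bar>\<beta> i\<bar> \<in> {1..int n} \<longleftrightarrow> \<bar>i\<bar> \<in> {1..int n}"
proof -
  have "\<beta> i \<in> {- int n..int n} - {0} \<longleftrightarrow> i \<in> {- int n..int n} - {0}"
    using assms by (intro permutes_in_image) (simp add: B_group_def)
  then show ?thesis
    by auto
qed

lemma B_group_inv_apply [simp]: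
  assumes "\<beta> \<in> B_group n"
  shows "inv \<beta> (\<beta> x) = x" "\<beta> (inv \<beta> x) = x"
  using B_group_bij[OF assms] by (simp_all add: bij_is_inj bij_is_surj surj_f_inv_f)

lemma B_group_inv:
  assumes "\<beta> \<in> B_group n"
  shows "inv \<beta> \<in> B_group n"
proof -
  have "inv \<beta> (- x) = - inv \<beta> x" for x
    using B_group_odd[OF assms, of "inv \<beta> x"] assms by (metis B_group_inv_apply)
  then show ?thesis
    using assms by (auto simp: B_group_def permutes_inv)
qed

lemma B_group_eq_iff: "\<beta> \<in> B_group n \<Longrightarrow> \<beta> x = \<beta> y \<longleftrightarrow> x = y"
  using B_group_bij by (metis bij_is_inj inj_eq)

lemma B_group_abs_eq_iff:
  assumes "\<beta> \<in> B_group n"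
  shows "\<bar>\<beta> x\<bar> = \<bar>\<beta> y\<bar> \<longleftrightarrow> \<bar>x\<bar> = \<bar>y\<bar>"
  by (simp add: abs_eq_iff B_group_eq_iff[OF assms] flip: B_group_odd[OF assms])

definition window :: "nat \<Rightarrow> (int \<Rightarrow> int) \<Rightarrow> int list" where
  "window n \<beta> = map \<beta> [1..int n]"

definition negated :: "nat \<Rightarrow> (int \<Rightarrow> int) \<Rightarrow> nat set" where
  "negated n \<beta> = {b \<in> {1..n}. inv \<beta> (int b) < 0}"

lemma negated_subset: "negated n \<beta> \<subseteq> {1..n}"
  by (auto simp: negated_def)

lemma finite_negated [simp]: "finite (negated n \<beta>)"
  by (rule finite_subset[OF negated_subset]) simp

lemma length_window [simp]: "length (window n \<beta>) = n"
  by (simp add: window_def)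

lemma nth_window [simp]: "i < n \<Longrightarrow> window n \<beta> ! i = \<beta> (1 + int i)"
  by (simp add: window_def)

lemma set_window: "set (window n \<beta>) = \<beta> ` {1..int n}"
  by (simp add: window_def)

lemma distinct_window: "\<beta> \<in> B_group n \<Longrightarrow> distinct (window n \<beta>)"
  by (simp add: window_def distinct_map inj_on_def B_group_eq_iff)

lemma mem_signed_values:
  "x \<in> signed_values n S \<longleftrightarrow> \<bar>x\<bar> \<in> {1..int n} \<and> (x < 0 \<longleftrightarrow> nat \<bar>x\<bar> \<in> S)"
proof
  assume "\<bar>x\<bar> \<in> {1..int n} \<and> (x < 0 \<longleftrightarrow> nat \<bar>x\<bar> \<in> S)"
  then have "x = signed S (nat \<bar>x\<bar>)" "nat \<bar>x\<bar> \<in> {1..n}"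
    by (auto simp: signed_def)
  then show "x \<in> signed_values n S"
    unfolding signed_values_def by (rule image_eqI)
qed (auto simp: signed_values_def signed_def)

lemma signed_values_inject:
  assumes "signed_values n S = signed_values n T" "S \<subseteq> {1..n}" "T \<subseteq> {1..n}"
  shows "S = T"
proof -
  have "b \<in> A \<longleftrightarrow> - int b \<in> signed_values n A" if "b \<in> {1..n}" for b A
    using that by (auto simp: mem_signed_values)
  with assms show ?thesis
    by blast
qed

lemma signed_values_negated:
  assumes "\<beta> \<in> B_group n"
  shows "signed_values n (negated n \<beta>) = \<beta> ` {1..int n}"
proof (rule set_eqI)
  fix x
  note inv = B_group_inv[OF assms]
  have "x \<in> \<beta> ` {1..int n} \<longleftrightarrow> inv \<beta> x \<in> {1..int n}"
    using inj_image_mem_iff[OF bij_is_inj[OF B_group_bij[OF assms]], of "inv \<beta> x"] assms by simp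
  also have "\<dots> \<longleftrightarrow> \<bar>x\<bar> \<in> {1..int n} \<and> inv \<beta> x > 0"
    using B_group_abs_mem_iff[OF inv, of x] by auto
  also have "\<dots> \<longleftrightarrow> x \<in> signed_values n (negated n \<beta>)"
    using B_group_abs_mem_iff[OF inv, of x] B_group_odd[OF inv, of x]
    by (cases "x < 0") (auto simp: mem_signed_values negated_def)
  finally show "x \<in> signed_values n (negated n \<beta>) \<longleftrightarrow> x \<in> \<beta> ` {1..int n}" ..
qed

lemma inj_on_window: "inj_on (window n) (B_group n)"
proof (intro inj_onI ext)
  fix \<beta> \<beta>' i assume mem: "\<beta> \<in> B_group n" "\<beta>' \<in> B_group n" and eq: "window n \<beta> = window n \<beta>'"
  have pos: "\<beta> i = \<beta>' i" if "i \<in> {1..int n}" for i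
    using that eq by (simp add: window_def)
  consider "i \<in> {1..int n}" | "- i \<in> {1..int n}" | "i \<notin> {- int n..int n} - {0}"
    by force
  then show "\<beta> i = \<beta>' i"
  proof cases
    case 2
    then show ?thesis
      using pos[of "- i"] B_group_odd[OF mem(1), of i] B_group_odd[OF mem(2), of i] by simp
  next
    case 3
    then show ?thesis
      using mem B_group_outside by metis
  qed (rule pos)
qed

lemma window_surj:
  assumes w: "w \<in> permutations_of_set (signed_values n S)"
  obtains \<beta> where "\<beta> \<in> B_group n" "window n \<beta> = w"
proof
  let ?dom = "{- int n..int n} - {0}"
  define \<beta> where "\<beta> i = (if i \<in> ?dom then sgn i * w ! (nat \<bar>i\<bar> - 1) else i)" for i
  have len: "length w = n" and set_w: "set w = signed_values n S"
    using w length_finite_permutations_of_set[OF w] by (simp_all add: permutations_of_set_def)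
  have odd: "\<beta> (- i) = - \<beta> i" for i
    by (simp add: \<beta>_def)
  have "?dom \<subseteq> \<beta> ` ?dom"
  proof
    fix y assume y: "y \<in> ?dom"
    then have "signed S (nat \<bar>y\<bar>) \<in> set w"
      by (auto simp: set_w signed_values_def intro!: imageI)
    then obtain k where k: "k < n" "w ! k = signed S (nat \<bar>y\<bar>)"
      by (metis in_set_conv_nth len)
    then have "\<beta> (int (Suc k)) = signed S (nat \<bar>y\<bar>)"
      by (simp add: \<beta>_def nat_add_distrib)
    then have "y = \<beta> (int (Suc k)) \<or> y = \<beta> (- int (Suc k))"
      unfolding odd by (auto simp: signed_def)
    moreover have "int (Suc k) \<in> ?dom" "- int (Suc k) \<in> ?dom"
      using k(1) by auto
    ultimately show "y \<in> \<beta> ` ?dom"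
      by blast
  qed
  moreover from this have "\<beta> ` ?dom = ?dom"
    by (intro card_seteq[symmetric] card_image_le) auto
  ultimately have "bij_betw \<beta> ?dom ?dom"
    unfolding bij_betw_def using finite_surj_inj[of ?dom \<beta>] by simp
  then have "\<beta> permutes ?dom"
    by (intro bij_imp_permutes) (auto simp: \<beta>_def)
  with odd show "\<beta> \<in> B_group n"
    by (simp add: B_group_def)
  show "window n \<beta> = w"
    by (rule nth_equalityI) (auto simp: len \<beta>_def nat_add_distrib)
qed

lemma bij_betw_window:
  assumes "S \<subseteq> {1..n}"
  shows "bij_betw (window n) {\<beta> \<in> B_group n. negated n \<beta> = S} (permutations_of_set (signed_values n S))"
  unfolding bij_betw_def
proof (intro conjI equalityI subsetI)
  show "inj_on (window n) {\<beta> \<in> B_group n. negated n \<beta> = S}"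
    by (rule inj_on_subset[OF inj_on_window]) auto
  show "w \<in> permutations_of_set (signed_values n S)"
    if "w \<in> window n ` {\<beta> \<in> B_group n. negated n \<beta> = S}" for w
    using that by (auto simp: permutations_of_set_def set_window signed_values_negated distinct_window)
next
  fix w assume w: "w \<in> permutations_of_set (signed_values n S)"
  then obtain \<beta> where \<beta>: "\<beta> \<in> B_group n" "window n \<beta> = w"
    by (rule window_surj)
  then have "signed_values n (negated n \<beta>) = signed_values n S"
    using w by (simp add: signed_values_negated permutations_of_set_def flip: set_window)
  then have "negated n \<beta> = S"
    by (rule signed_values_inject[OF _ negated_subset assms])
  with \<beta> show "w \<in> window n ` {\<beta> \<in> B_group n. negated n \<beta> = S}"
    by blast
qed

lemma sorted_wrt_strict_sorted_iff:
  fixes xs :: "'a::linorder list"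
  assumes "sorted_wrt (<) xs"
  shows "sorted_wrt P xs \<longleftrightarrow> (\<forall>x\<in>set xs. \<forall>y\<in>set xs. x < y \<longrightarrow> P x y)"
  using assms by (induction xs) (auto dest: order.asym)

lemma strict_mono_on_image_inv_iff:
  fixes g :: "'a::linorder \<Rightarrow> 'b::linorder"
  assumes "inj g"
  shows "strict_mono_on (g ` A) (inv g) \<longleftrightarrow> strict_mono_on A g"
proof
  assume "strict_mono_on (g ` A) (inv g)"
  from strict_mono_on_less[OF this imageI imageI] show "strict_mono_on A g"
    by (intro strict_mono_onI) (simp add: assms)
next
  assume "strict_mono_on A g"
  from strict_mono_on_less[OF this] show "strict_mono_on (g ` A) (inv g)"
    by (auto simp: assms intro!: strict_mono_onI)
qed

lemma sorted_wrt_window_iff: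
  assumes "\<beta> \<in> B_group n"
  shows "sorted_wrt (\<lambda>x y. f x = f y \<longrightarrow> x < y) (window n \<beta>) \<longleftrightarrow>
    (\<forall>k. strict_mono_on (fiber f (\<beta> ` {1..int n}) k) (inv \<beta>))"
proof -
  have "sorted_wrt (\<lambda>x y. f x = f y \<longrightarrow> x < y) (window n \<beta>) \<longleftrightarrow>
      (\<forall>k. strict_mono_on {i \<in> {1..int n}. f (\<beta> i) = k} \<beta>)"
    unfolding window_def sorted_wrt_map sorted_wrt_strict_sorted_iff[OF sorted_wrt_upto]
    by (auto simp: strict_mono_on_def)
  also have "\<dots> \<longleftrightarrow> (\<forall>k. strict_mono_on (\<beta> ` {i \<in> {1..int n}. f (\<beta> i) = k}) (inv \<beta>))"
    by (simp add: strict_mono_on_image_inv_iff bij_is_inj[OF B_group_bij[OF assms]])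
  moreover have "\<beta> ` {i \<in> {1..int n}. f (\<beta> i) = k} = fiber f (\<beta> ` {1..int n}) k" for k
    by auto
  ultimately show ?thesis
    by simp
qed

lemma maj_eq_list_maj: "maj n \<beta> = list_maj (window n \<beta>)"
proof -
  have "Des n \<beta> = {i \<in> {1..<length (window n \<beta>)}. window n \<beta> ! (i - 1) > window n \<beta> ! i}"
    by (auto simp: Des_def add.commute)
  then show ?thesis
    by (simp add: maj_def list_maj_def)
qed

lemma inversion_number_eq_list_inv: "inversion_number n \<beta> = list_inv (window n \<beta>)"
proof -
  let ?A = "{(i, j). i < j \<and> j < length (window n \<beta>) \<and> window n \<beta> ! i > window n \<beta> ! j}"
  have "{(i, j). 1 \<le> i \<and> i < j \<and> j \<le> n \<and> \<beta> (int i) > \<beta> (int j)} = map_prod Suc Suc ` ?A"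
  proof (intro equalityI subsetI, clarify)
    fix i j :: nat assume "1 \<le> i" "i < j" "j \<le> n" "\<beta> (int i) > \<beta> (int j)"
    then have "(i, j) = map_prod Suc Suc (i - 1, j - 1)" "(i - 1, j - 1) \<in> ?A"
      by auto
    then show "(i, j) \<in> map_prod Suc Suc ` ?A"
      by (rule image_eqI)
  qed auto
  moreover have "inj_on (map_prod Suc Suc) ?A"
    by (auto simp: inj_on_def)
  ultimately show ?thesis
    by (simp add: inversion_number_def list_inv_def card_image)
qed

definition abs_entry :: "(int \<Rightarrow> int) \<Rightarrow> nat \<Rightarrow> nat" where
  "abs_entry \<beta> i = nat \<bar>\<beta> (int i)\<bar>"

lemma bij_betw_abs_entry:
  assumes "\<beta> \<in> B_group n"
  shows "bij_betw (abs_entry \<beta>) {1..n} {1..n}"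
proof -
  have "inj_on (abs_entry \<beta>) {1..n}"
    using B_group_abs_eq_iff[OF assms] by (auto simp: inj_on_def abs_entry_def eq_nat_nat_iff)
  moreover have "abs_entry \<beta> i \<in> {1..n}" if "i \<in> {1..n}" for i
    using B_group_abs_mem_iff[OF assms, of "int i"] that by (auto simp: abs_entry_def)
  ultimately show ?thesis
    unfolding bij_betw_def by (intro conjI endo_inj_surj) auto
qed

lemma abs_entry_mem_negated_iff:
  assumes "\<beta> \<in> B_group n" "i \<in> {1..n}"
  shows "abs_entry \<beta> i \<in> negated n \<beta> \<longleftrightarrow> \<beta> (int i) < 0"
proof -
  have "abs_entry \<beta> i \<in> {1..n}"
    using bij_betw_apply[OF bij_betw_abs_entry[OF assms(1)] assms(2)] .
  moreover have "inv \<beta> (- \<beta> (int i)) = - int i"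
    using B_group_odd[OF B_group_inv[OF assms(1)], of "\<beta> (int i)"] assms(1) by simp
  ultimately show ?thesis
    using assms by (auto simp: negated_def abs_entry_def abs_if)
qed

lemma card_negated:
  assumes "\<beta> \<in> B_group n"
  shows "card (negated n \<beta>) = card {i \<in> {1..n}. \<beta> (int i) < 0}"
proof -
  have "bij_betw (abs_entry \<beta>) {i \<in> {1..n}. \<beta> (int i) < 0} {b \<in> {1..n}. b \<in> negated n \<beta>}"
    using assms by (intro bij_betw_Collect bij_betw_abs_entry abs_entry_mem_negated_iff)
  moreover have "{b \<in> {1..n}. b \<in> negated n \<beta>} = negated n \<beta>"
    using negated_subset by blast
  ultimately show ?thesis
    using bij_betw_same_card by metis
qed

lemma sum_neg_iff_mem_negated:
  assumes "\<beta> \<in> B_group n" "j \<in> {1..n}" "abs_entry \<beta> i < abs_entry \<beta> j"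
  shows "\<beta> (int i) + \<beta> (int j) < 0 \<longleftrightarrow> abs_entry \<beta> j \<in> negated n \<beta>"
  using abs_entry_mem_negated_iff[OF assms(1,2)] assms(3) by (auto simp: abs_entry_def)

definition negative_pairs :: "nat \<Rightarrow> (int \<Rightarrow> int) \<Rightarrow> nat set set" where
  "negative_pairs n \<beta> = {{i, j} |i j. i \<in> {1..n} \<and> j \<in> {1..n} \<and> i \<noteq> j \<and> \<beta> (int i) + \<beta> (int j) < 0}"

definition pairs_below :: "nat set \<Rightarrow> nat set set" where
  "pairs_below N = {{a, b} |a b. b \<in> N \<and> a \<in> {1..<b}}"

lemma card_pairs_below:
  assumes "finite N"
  shows "card (pairs_below N) = (\<Sum>b\<in>N. b - 1)"
proof -
  have "pairs_below N = (\<lambda>(b, a). {a, b}) ` (SIGMA b:N. {1..<b})"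
    by (fastforce simp: pairs_below_def image_def)
  moreover have "inj_on (\<lambda>(b, a). {a, b}) (SIGMA b:N. {1..<b})"
    by (auto simp: inj_on_def doubleton_eq_iff)
  ultimately show ?thesis
    using assms by (simp add: card_image)
qed

lemma abs_entry_image_negative_pairs:
  assumes "\<beta> \<in> B_group n"
  shows "(`) (abs_entry \<beta>) ` negative_pairs n \<beta> = pairs_below (negated n \<beta>)"
proof (intro equalityI subsetI)
  note bij = bij_betw_abs_entry[OF assms]
  have below: "{abs_entry \<beta> i, abs_entry \<beta> j} \<in> pairs_below (negated n \<beta>)"
    if "i \<in> {1..n}" "j \<in> {1..n}" "abs_entry \<beta> i < abs_entry \<beta> j" "\<beta> (int i) + \<beta> (int j) < 0" for i j
  proof -
    have "abs_entry \<beta> j \<in> negated n \<beta>" "abs_entry \<beta> i \<in> {1..<abs_entry \<beta> j}"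
      using that sum_neg_iff_mem_negated[OF assms that(2,3)] bij_betw_apply[OF bij that(1)] by simp_all
    then show ?thesis
      unfolding pairs_below_def by blast
  qed
  fix X assume "X \<in> (`) (abs_entry \<beta>) ` negative_pairs n \<beta>"
  then obtain i j where ij: "i \<in> {1..n}" "j \<in> {1..n}" "i \<noteq> j" "\<beta> (int i) + \<beta> (int j) < 0"
    and X: "X = {abs_entry \<beta> i, abs_entry \<beta> j}"
    by (auto simp: negative_pairs_def)
  have "i = j" if "abs_entry \<beta> i = abs_entry \<beta> j"
    by (rule inj_onD[OF bij_betw_imp_inj_on[OF bij] that ij(1,2)])
  with ij(3) show "X \<in> pairs_below (negated n \<beta>)"
    using below[of i j] below[of j i] ij X by (metis add.commute insert_commute linorder_neqE_nat)
next
  fix X assume "X \<in> pairs_below (negated n \<beta>)"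
  then obtain a b where ab: "b \<in> negated n \<beta>" "a \<in> {1..<b}" "X = {a, b}"
    by (auto simp: pairs_below_def)
  then have "a \<in> {1..n}" "b \<in> {1..n}"
    using negated_subset[of n \<beta>] by auto
  then have "a \<in> abs_entry \<beta> ` {1..n}" "b \<in> abs_entry \<beta> ` {1..n}"
    unfolding bij_betw_imp_surj_on[OF bij_betw_abs_entry[OF assms]] .
  then obtain i j where ij: "i \<in> {1..n}" "abs_entry \<beta> i = a" "j \<in> {1..n}" "abs_entry \<beta> j = b"
    by blast
  then have "i \<noteq> j" "\<beta> (int i) + \<beta> (int j) < 0"
    using ab(1,2) sum_neg_iff_mem_negated[OF assms ij(3), of i] by auto
  with ij(1,3) have "{i, j} \<in> negative_pairs n \<beta>"
    unfolding negative_pairs_def by blast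
  moreover have "X = abs_entry \<beta> ` {i, j}"
    by (simp add: ab(3) ij(2,4))
  ultimately show "X \<in> (`) (abs_entry \<beta>) ` negative_pairs n \<beta>"
    by (rule rev_image_eqI)
qed

lemma N2_eq_sum_negated:
  assumes "\<beta> \<in> B_group n"
  shows "N2 n \<beta> = (\<Sum>b\<in>negated n \<beta>. b - 1)"
proof -
  have "negative_pairs n \<beta> \<subseteq> Pow {1..n}"
    by (auto simp: negative_pairs_def)
  then have "inj_on ((`) (abs_entry \<beta>)) (negative_pairs n \<beta>)"
    by (rule inj_on_subset[OF inj_on_image_Pow[OF bij_betw_imp_inj_on[OF bij_betw_abs_entry[OF assms]]]])
  then have "card (negative_pairs n \<beta>) = card (pairs_below (negated n \<beta>))"
    unfolding abs_entry_image_negative_pairs[OF assms, symmetric] by (rule card_image[symmetric])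
  then show ?thesis
    by (simp only: N2_def negative_pairs_def card_pairs_below[OF finite_negated])
qed

section \<open>Descents of the inverse\<close>

lemma strict_mono_on_interval_iff_Suc:
  "strict_mono_on {c<..d} g \<longleftrightarrow> (\<forall>i\<in>{c<..<d}. g i < g (Suc i))"
  for g :: "nat \<Rightarrow> 'a::order"
proof
  assume "\<forall>i\<in>{c<..<d}. g i < g (Suc i)"
  then have "g i < g j" if "i < j" "i \<in> {c<..d}" "j \<in> {c<..d}" for i j
    using that by (intro lift_Suc_mono_less_ivl[of "{c<..<d}" g i j]) auto
  then show "strict_mono_on {c<..d} g"
    by (auto intro: strict_mono_onI)
qed (auto simp: strict_mono_on_def)

lemma strict_mono_on_image_iff:
  "strict_mono_on (h ` A) p \<longleftrightarrow> (\<forall>x\<in>A. \<forall>y\<in>A. h x < h y \<longrightarrow> p (h x) < p (h y))"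
  by (auto simp: strict_mono_on_def)

lemma strict_mono_on_iff_signs:
  fixes g :: "'a::linorder \<Rightarrow> int"
  shows "strict_mono_on A g \<longleftrightarrow> {b \<in> A. g b < 0} \<in> down_sets A \<and>
    strict_mono_on {b \<in> A. \<not> g b < 0} g \<and> strict_mono_on {b \<in> A. g b < 0} g"
proof
  assume mono: "strict_mono_on A g"
  have "g u < 0" if "u \<in> A" "v \<in> A" "u < v" "g v < 0" for u v
    using strict_mono_onD[OF mono that(1-3)] that(4) by simp
  then show "{b \<in> A. g b < 0} \<in> down_sets A \<and>
      strict_mono_on {b \<in> A. \<not> g b < 0} g \<and> strict_mono_on {b \<in> A. g b < 0} g"
    by (auto simp: down_sets_def intro: monotone_on_subset[OF mono])
next
  assume signs: "{b \<in> A. g b < 0} \<in> down_sets A \<and>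
    strict_mono_on {b \<in> A. \<not> g b < 0} g \<and> strict_mono_on {b \<in> A. g b < 0} g"
  show "strict_mono_on A g"
  proof (rule strict_mono_onI)
    fix u v assume "u \<in> A" "v \<in> A" "u < v"
    with signs show "g u < g v"
      by (cases "g u < 0"; cases "g v < 0") (auto simp: down_sets_def strict_mono_on_def)
  qed
qed

lemma strict_mono_on_sum_pos_iff:
  fixes g :: "nat \<Rightarrow> int"
  assumes "d \<ge> 2"
  shows "strict_mono_on {1..d} g \<and> g 1 + g 2 > 0 \<longleftrightarrow> (\<forall>u\<in>{1..d}. \<forall>v\<in>{1..d}. u < v \<longrightarrow> \<bar>g u\<bar> < g v)"
proof (intro iffI ballI impI)
  fix u v assume mono_sum_pos: "strict_mono_on {1..d} g \<and> g 1 + g 2 > 0"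
    and uv: "u \<in> {1..d}" "v \<in> {1..d}" "u < v"
  then have mono: "strict_mono_on {1..d} g" and "g 1 + g 2 > 0"
    by simp_all
  moreover have "g u < g v"
    by (rule strict_mono_onD[OF mono uv])
  moreover have "g 1 \<le> g u" "g 2 \<le> g v"
    using strict_mono_on_leD[OF mono, of 1 u] strict_mono_on_leD[OF mono, of 2 v] uv assms by simp_all
  ultimately show "\<bar>g u\<bar> < g v"
    by linarith
next
  assume "\<forall>u\<in>{1..d}. \<forall>v\<in>{1..d}. u < v \<longrightarrow> \<bar>g u\<bar> < g v"
  then have abs_less: "\<bar>g u\<bar> < g v" if "u \<in> {1..d}" "v \<in> {1..d}" "u < v" for u v
    using that by blast
  have "g u < g v" if "u \<in> {1..d}" "v \<in> {1..d}" "u < v" for u v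
    using abs_less[OF that] by linarith
  then have "strict_mono_on {1..d} g"
    by (rule strict_mono_onI)
  moreover have "\<bar>g 1\<bar> < g 2"
    using abs_less[of 1 2] assms by simp
  ultimately show "strict_mono_on {1..d} g \<and> g 1 + g 2 > 0"
    by simp
qed

lemma strict_mono_on_abs_iff:
  fixes g :: "nat \<Rightarrow> int"
  shows "{b \<in> {1..d}. g b < 0} \<subseteq> {1} \<and> strict_mono_on {1..d} (\<lambda>b. \<bar>g b\<bar>) \<longleftrightarrow>
    (\<forall>u\<in>{1..d}. \<forall>v\<in>{1..d}. u < v \<longrightarrow> \<bar>g u\<bar> < g v)"
proof (intro iffI ballI impI)
  fix u v assume neg_mono: "{b \<in> {1..d}. g b < 0} \<subseteq> {1} \<and> strict_mono_on {1..d} (\<lambda>b. \<bar>g b\<bar>)"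
    and uv: "u \<in> {1..d}" "v \<in> {1..d}" "u < v"
  have "\<bar>g u\<bar> < \<bar>g v\<bar>"
    by (rule strict_mono_onD[OF conjunct2[OF neg_mono] uv])
  moreover have "v \<noteq> 1"
    using uv by auto
  then have "\<not> g v < 0"
    using neg_mono uv(2) by blast
  ultimately show "\<bar>g u\<bar> < g v"
    by simp
next
  assume "\<forall>u\<in>{1..d}. \<forall>v\<in>{1..d}. u < v \<longrightarrow> \<bar>g u\<bar> < g v"
  then have abs_less: "\<bar>g u\<bar> < g v" if "u \<in> {1..d}" "v \<in> {1..d}" "u < v" for u v
    using that by blast
  have "\<bar>g u\<bar> < \<bar>g v\<bar>" if "u \<in> {1..d}" "v \<in> {1..d}" "u < v" for u v
    using abs_less[OF that] by linarith
  then have "strict_mono_on {1..d} (\<lambda>b. \<bar>g b\<bar>)"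
    by (rule strict_mono_onI)
  moreover have "b = 1" if "b \<in> {1..d}" "g b < 0" for b
  proof (rule ccontr)
    assume "b \<noteq> 1"
    then have "\<bar>g 1\<bar> < g b"
      using abs_less[of 1 b] that(1) by simp
    with that(2) show False
      by simp
  qed
  ultimately show "{b \<in> {1..d}. g b < 0} \<subseteq> {1} \<and> strict_mono_on {1..d} (\<lambda>b. \<bar>g b\<bar>)"
    by blast
qed

context block_partition
begin

definition increasing_on_blocks :: "(int \<Rightarrow> int) \<Rightarrow> bool" where
  "increasing_on_blocks p \<longleftrightarrow>
    (\<forall>j\<le>t. strict_mono_on (block j) (\<lambda>b. p (int b))) \<and> (\<mu> 1 \<noteq> 0 \<longrightarrow> p 1 + p 2 > 0)"

lemma nonboundary_eq: "{1..<n} - \<mu> ` {1..t} = (\<Union>j\<le>t. {\<mu> j<..<\<mu> (Suc j)})"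
proof (intro equalityI subsetI)
  fix i assume i: "i \<in> {1..<n} - \<mu> ` {1..t}"
  then obtain j where j: "j \<le> t" "i \<in> block j"
    using UN_block by (metis Diff_iff UN_E atLeastAtMost_iff atLeastLessThan_iff atMost_iff less_imp_le)
  have "i \<noteq> \<mu> (Suc j)"
  proof (cases "j = t")
    case True
    then show ?thesis
      using i final by simp
  next
    case False
    then have "Suc j \<in> {1..t}"
      using j(1) by simp
    then show ?thesis
      using i by blast
  qed
  then show "i \<in> (\<Union>j\<le>t. {\<mu> j<..<\<mu> (Suc j)})"
    using j by (auto simp: block_def)
next
  fix i assume "i \<in> (\<Union>j\<le>t. {\<mu> j<..<\<mu> (Suc j)})"
  then obtain j where j: "j \<le> t" "\<mu> j < i" "i < \<mu> (Suc j)"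
    by auto
  have "i \<noteq> \<mu> k" if "k \<in> {1..t}" for k
    using boundary_mono[of k j] boundary_mono[of "Suc j" k] j that by (cases "k \<le> j") auto
  then have "i \<notin> \<mu> ` {1..t}"
    by blast
  moreover have "i \<in> {1..<n}"
    using boundary_mono[of "Suc j" "Suc t"] j final by auto
  ultimately show "i \<in> {1..<n} - \<mu> ` {1..t}"
    by simp
qed

lemma zero_boundary_iff:
  assumes "n \<ge> 1"
  shows "0 \<in> \<mu> ` {1..t} \<longleftrightarrow> \<mu> 1 = 0"
proof
  assume "0 \<in> \<mu> ` {1..t}"
  then obtain k where "k \<in> {1..t}" "\<mu> k = 0"
    by auto
  then show "\<mu> 1 = 0"
    using boundary_mono[of 1 k] by simp
next
  assume "\<mu> 1 = 0"
  moreover from this have "t \<noteq> 0"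
    using final assms by (intro notI) simp
  ultimately show "0 \<in> \<mu> ` {1..t}"
    by (intro image_eqI[of _ _ 1]) auto
qed

lemma Des_D_subset_iff:
  assumes "p \<in> B_group n" "n \<ge> 2"
  shows "Des_D n p \<subseteq> \<mu> ` {1..t} \<longleftrightarrow> increasing_on_blocks p"
proof -
  have "p 1 + p 2 \<noteq> 0"
    using B_group_abs_eq_iff[OF assms(1), of 1 2] by auto
  then have zero: "0 \<in> Des_D n p \<longleftrightarrow> \<not> p 1 + p 2 > 0"
    by (auto simp: Des_D_def)
  have "i \<in> Des_D n p \<longleftrightarrow> \<not> p (int i) < p (int (Suc i))" if "i \<in> {1..<n}" for i
    using that B_group_eq_iff[OF assms(1), of "int i" "int (Suc i)"]
    by (auto simp: Des_D_def add.commute)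
  moreover have "i = 0 \<or> i \<in> {1..<n}" if "i \<in> Des_D n p" for i
    using that assms(2) by (auto simp: Des_D_def)
  ultimately have "Des_D n p =
      {i \<in> {1..<n}. \<not> p (int i) < p (int (Suc i))} \<union> {i. i = 0 \<and> \<not> p 1 + p 2 > 0}"
    using zero by blast
  then have "Des_D n p \<subseteq> \<mu> ` {1..t} \<longleftrightarrow>
      (\<forall>i\<in>{1..<n} - \<mu> ` {1..t}. p (int i) < p (int (Suc i))) \<and> (0 \<notin> \<mu> ` {1..t} \<longrightarrow> p 1 + p 2 > 0)"
    by blast
  also have "\<dots> \<longleftrightarrow> increasing_on_blocks p"
    unfolding nonboundary_eq increasing_on_blocks_def block_def strict_mono_on_interval_iff_Suc ball_UN
    using zero_boundary_iff assms(2) by (simp add: Ball_def)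
  finally show ?thesis .
qed

lemma strict_mono_on_fibers_iff:
  "(\<forall>k. strict_mono_on (fiber signed_label (signed_values n S) k) p) \<longleftrightarrow>
    strict_mono_on (signed S ` block 0) p \<and>
    (\<forall>j\<in>{1..t}. strict_mono_on (int ` (block j - S)) p \<and>
      strict_mono_on ((\<lambda>b. - int b) ` (block j \<inter> S)) p)"
  (is "(\<forall>k. ?M k) \<longleftrightarrow> ?R")
proof -
  have "?M k" if "k \<notin> {- int t..int t}" for k
  proof -
    have "fiber signed_label (signed_values n S) k = {}"
      using that signed_label_image_subset[of S] by (auto simp: fiber_def)
    then show ?thesis
      by simp
  qed
  moreover have "k \<in> {- int t..int t} \<longleftrightarrow> k = 0 \<or> (\<exists>j\<in>{1..t}. k = int j \<or> k = - int j)" for k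
    by (cases k rule: int_cases2) auto
  ultimately have "(\<forall>k. ?M k) \<longleftrightarrow> ?M 0 \<and> (\<forall>j\<in>{1..t}. ?M (int j) \<and> ?M (- int j))"
    by metis
  then show ?thesis
    by (simp add: fiber_signed_label_0 fiber_signed_label_pos fiber_signed_label_neg)
qed

text \<open>In the first block \<open>-1\<close> and the positive values share a label: the condition at \<open>0\<close> makes
  \<open>-1\<close> precede \<open>2\<close> exactly as the condition at \<open>1\<close> makes \<open>1\<close> precede \<open>2\<close>.\<close>

lemma increasing_first_block_iff:
  fixes p :: "int \<Rightarrow> int"
  assumes odd: "\<And>x. p (- x) = - p x" and "\<mu> 1 \<noteq> 1"
    and neg_iff: "\<And>b. b \<in> block 0 \<Longrightarrow> b \<in> N \<longleftrightarrow> p (int b) < 0"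
  shows "strict_mono_on (block 0) (\<lambda>b. p (int b)) \<and> (\<mu> 1 \<noteq> 0 \<longrightarrow> p 1 + p 2 > 0) \<longleftrightarrow>
    N \<inter> block 0 \<in> block_negations 0 \<and> strict_mono_on (signed N ` block 0) p"
proof (cases "\<mu> 1 = 0")
  case True
  then show ?thesis
    by (simp add: block_0 block_negations_def)
next
  case False
  have N_block: "N \<inter> {1..\<mu> 1} = {b \<in> {1..\<mu> 1}. p (int b) < 0}"
    using neg_iff by (auto simp: block_0)
  have "strict_mono_on (block 0) (\<lambda>b. p (int b)) \<and> p 1 + p 2 > 0 \<longleftrightarrow>
      N \<inter> block 0 \<subseteq> {1} \<and> strict_mono_on (block 0) (\<lambda>b. \<bar>p (int b)\<bar>)"
    unfolding block_0 N_block strict_mono_on_abs_iff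
    using strict_mono_on_sum_pos_iff[of "\<mu> 1" "\<lambda>b. p (int b)"] False assms(2) by simp
  also have "\<dots> \<longleftrightarrow> N \<inter> block 0 \<subseteq> {1} \<and> strict_mono_on (signed N ` block 0) p"
  proof (rule conj_cong[OF refl])
    assume "N \<inter> block 0 \<subseteq> {1}"
    then have only_1: "b = 1" if "b \<in> N" "b \<in> block 0" for b
      using that by blast
    have "signed N x < signed N y \<longleftrightarrow> x < y" if "x \<in> block 0" "y \<in> block 0" for x y
      using that only_1[of x] only_1[of y] by (cases "x = y") (auto simp: signed_def block_0)
    moreover have "p (signed N b) = \<bar>p (int b)\<bar>" if "b \<in> block 0" for b
      using neg_iff[OF that] by (simp add: signed_def odd)
    ultimately have "strict_mono_on (signed N ` block 0) p \<longleftrightarrow>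
        (\<forall>x\<in>block 0. \<forall>y\<in>block 0. x < y \<longrightarrow> \<bar>p (int x)\<bar> < \<bar>p (int y)\<bar>)"
      by (simp add: strict_mono_on_image_iff)
    then show "strict_mono_on (block 0) (\<lambda>b. \<bar>p (int b)\<bar>) \<longleftrightarrow> strict_mono_on (signed N ` block 0) p"
      by (auto simp: strict_mono_on_def)
  qed
  finally show ?thesis
    using False by (auto simp: block_negations_def)
qed

lemma increasing_block_iff:
  fixes p :: "int \<Rightarrow> int"
  assumes odd: "\<And>x. p (- x) = - p x" and "j \<noteq> 0"
    and neg_iff: "\<And>b. b \<in> block j \<Longrightarrow> b \<in> N \<longleftrightarrow> p (int b) < 0"
  shows "strict_mono_on (block j) (\<lambda>b. p (int b)) \<longleftrightarrow> N \<inter> block j \<in> block_negations j \<and>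
    strict_mono_on (int ` (block j - N)) p \<and> strict_mono_on ((\<lambda>b. - int b) ` (block j \<inter> N)) p"
proof -
  have "N \<inter> block j = {b \<in> block j. p (int b) < 0}" "block j \<inter> N = {b \<in> block j. p (int b) < 0}"
    "block j - N = {b \<in> block j. \<not> p (int b) < 0}"
    using neg_iff by auto
  moreover have "strict_mono_on ((\<lambda>b. - int b) ` A) p \<longleftrightarrow> strict_mono_on A (\<lambda>b. p (int b))" for A
    unfolding strict_mono_on_image_iff by (auto simp: strict_mono_on_def odd)
  moreover have "strict_mono_on (int ` A) p \<longleftrightarrow> strict_mono_on A (\<lambda>b. p (int b))" for A
    unfolding strict_mono_on_image_iff by (auto simp: strict_mono_on_def)
  ultimately show ?thesis
    using strict_mono_on_iff_signs[of "block j" "\<lambda>b. p (int b)"] assms(2)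
    by (simp add: block_negations_def)
qed

lemma increasing_on_blocks_iff:
  fixes p :: "int \<Rightarrow> int"
  assumes "\<And>x. p (- x) = - p x" "\<mu> 1 \<noteq> 1"
  defines "N \<equiv> {b \<in> {1..n}. p (int b) < 0}"
  shows "increasing_on_blocks p \<longleftrightarrow>
    N \<in> negations \<and> (\<forall>k. strict_mono_on (fiber signed_label (signed_values n N) k) p)"
proof -
  have neg_iff: "b \<in> N \<longleftrightarrow> p (int b) < 0" if "j \<le> t" "b \<in> block j" for j b
    using that block_subset[of j] by (auto simp: N_def)
  have all_blocks: "(\<forall>j\<le>t. P j) \<longleftrightarrow> P 0 \<and> (\<forall>j\<in>{1..t}. P j)" for P
    by (metis One_nat_def Suc_leI atLeastAtMost_iff le0 neq0_conv)
  have "strict_mono_on (block 0) (\<lambda>b. p (int b)) \<and> (\<mu> 1 \<noteq> 0 \<longrightarrow> p 1 + p 2 > 0) \<longleftrightarrow>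
      N \<inter> block 0 \<in> block_negations 0 \<and> strict_mono_on (signed N ` block 0) p"
    by (rule increasing_first_block_iff[OF assms(1,2) neg_iff]) auto
  moreover have "strict_mono_on (block j) (\<lambda>b. p (int b)) \<longleftrightarrow> N \<inter> block j \<in> block_negations j \<and>
      strict_mono_on (int ` (block j - N)) p \<and> strict_mono_on ((\<lambda>b. - int b) ` (block j \<inter> N)) p"
    if "j \<in> {1..t}" for j
    by (rule increasing_block_iff[OF assms(1) _ neg_iff]) (use that in auto)
  moreover have "N \<subseteq> {1..n}"
    by (auto simp: N_def)
  ultimately show ?thesis
    unfolding increasing_on_blocks_def negations_def strict_mono_on_fibers_iff all_blocks by blast
qed

lemma Des_D_inv_subset_iff:
  assumes "\<beta> \<in> B_group n" "n \<ge> 2" "\<mu> 1 \<noteq> 1"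
  shows "Des_D n (inv \<beta>) \<subseteq> \<mu> ` {1..t} \<longleftrightarrow> negated n \<beta> \<in> negations \<and>
    sorted_wrt (\<lambda>x y. signed_label x = signed_label y \<longrightarrow> x < y) (window n \<beta>)"
  using increasing_on_blocks_iff[where p = "inv \<beta>", OF B_group_odd[OF B_group_inv[OF assms(1)]] assms(3)]
  unfolding Des_D_subset_iff[OF B_group_inv[OF assms(1)] assms(2)] sorted_wrt_window_iff[OF assms(1)]
    signed_values_negated[OF assms(1), symmetric] negated_def .

end

section \<open>Generating functions over type D descent classes\<close>

locale mahonian_statistic = generic_q q
  for q :: "'q::field" +
  fixes g :: "int list \<Rightarrow> nat"
  assumes order_invariant: "strict_mono_on (set w) h \<Longrightarrow> g (map h w) = g w"
    and sum_block_words: "finite V \<Longrightarrow> mono_on V (f :: int \<Rightarrow> int) \<Longrightarrow>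
      (\<Sum>w\<in>block_words f V. q ^ g w) = block_multinomial q f V"

lemma (in generic_q) mahonian_statistic_list_maj: "mahonian_statistic q list_maj"
  by unfold_locales (simp_all add: list_maj_map sum_list_maj_block_words)

lemma (in generic_q) mahonian_statistic_list_inv: "mahonian_statistic q list_inv"
  by unfold_locales (simp_all add: list_inv_map sum_list_inv_block_words)

definition signed_stat :: "(int list \<Rightarrow> nat) \<Rightarrow> nat \<Rightarrow> (int \<Rightarrow> int) \<Rightarrow> nat" where
  "signed_stat g n \<beta> = g (window n \<beta>) + N2 n \<beta>"

lemma dmaj_eq_signed_stat: "dmaj n = signed_stat list_maj n"
  by (simp add: fun_eq_iff dmaj_def signed_stat_def maj_eq_list_maj)

lemma length_D_eq_signed_stat: "length_D n = signed_stat list_inv n"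
  by (simp add: fun_eq_iff length_D_def signed_stat_def inversion_number_eq_list_inv)

definition D_coset_of :: "nat \<Rightarrow> nat set \<Rightarrow> bool \<Rightarrow> (int \<Rightarrow> int) set" where
  "D_coset_of n M e = {\<beta> \<in> B_group n. Des_D n (inv \<beta>) \<subseteq> M \<and> (even (card (negated n \<beta>)) \<longleftrightarrow> e)}"

lemma D_of_eq_D_coset_of: "D_of n M = D_coset_of n M True"
  by (auto simp: D_of_def D_group_def D_coset_of_def card_negated)

locale mahonian_block_partition = q_block_partition n t \<mu> q + mahonian_statistic q g
  for n t :: nat and \<mu> :: "nat \<Rightarrow> nat" and q :: "'q::field" and g :: "int list \<Rightarrow> nat"
begin

lemma sum_fixed_negations:
  assumes "n \<ge> 2" "\<mu> 1 \<noteq> 1" and S: "S \<in> negations"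
  shows "(\<Sum>\<beta> | \<beta> \<in> B_group n \<and> negated n \<beta> = S \<and> Des_D n (inv \<beta>) \<subseteq> \<mu> ` {1..t}.
    q ^ signed_stat g n \<beta>) = negation_weight S"
proof -
  let ?Y = "{\<beta> \<in> {\<beta> \<in> B_group n. negated n \<beta> = S}. Des_D n (inv \<beta>) \<subseteq> \<mu> ` {1..t}}"
  have "S \<subseteq> {1..n}"
    using S by (simp add: negations_def)
  then have bij: "bij_betw (window n) ?Y (block_words signed_label (signed_values n S))"
    unfolding block_words_def using S Des_D_inv_subset_iff[OF _ assms(1,2)]
    by (intro bij_betw_Collect bij_betw_window) auto
  have "(\<Sum>\<beta>\<in>?Y. q ^ g (window n \<beta>)) = block_multinomial q signed_label (signed_values n S)"
    using sum.reindex_bij_betw[OF bij, of "\<lambda>w. q ^ g w"]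
      sum_block_words[OF finite_signed_values mono_on_subset[OF mono_signed_label]] by simp
  moreover have "(\<Sum>\<beta>\<in>?Y. q ^ signed_stat g n \<beta>) = (\<Sum>\<beta>\<in>?Y. q ^ (\<Sum>b\<in>S. b - 1) * q ^ g (window n \<beta>))"
    by (intro sum.cong refl) (auto simp: signed_stat_def N2_eq_sum_negated power_add)
  ultimately show ?thesis
    by (simp add: negation_weight_def sum_distrib_left[symmetric] conj_assoc)
qed

theorem sum_D_coset_of:
  assumes "n \<ge> 2" "\<mu> 1 \<noteq> 1" "(2::'q) \<noteq> 0"
  shows "(\<Sum>\<beta>\<in>D_coset_of n (\<mu> ` {1..t}) e. q ^ signed_stat g n \<beta>) =
    q_multinomial q n block_sizes * (\<Prod>i=max 1 (\<mu> 1)..<n. 1 + q ^ i)"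
proof -
  let ?D = "D_coset_of n (\<mu> ` {1..t}) e" and ?T = "{S. S \<in> negations \<and> (even (card S) \<longleftrightarrow> e)}"
  have "(\<Sum>\<beta>\<in>?D. q ^ signed_stat g n \<beta>) = (\<Sum>S\<in>?T. \<Sum>\<beta> | \<beta> \<in> ?D \<and> negated n \<beta> = S. q ^ signed_stat g n \<beta>)"
    using Des_D_inv_subset_iff[OF _ assms(1,2)]
    by (intro sum.group[symmetric]) (auto simp: D_coset_of_def finite_B_group)
  also have "\<dots> = (\<Sum>S\<in>?T. negation_weight S)"
  proof (intro sum.cong refl)
    fix S assume S: "S \<in> ?T"
    then have "{\<beta>. \<beta> \<in> ?D \<and> negated n \<beta> = S} =
        {\<beta>. \<beta> \<in> B_group n \<and> negated n \<beta> = S \<and> Des_D n (inv \<beta>) \<subseteq> \<mu> ` {1..t}}"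
      by (auto simp: D_coset_of_def)
    with S show "(\<Sum>\<beta> | \<beta> \<in> ?D \<and> negated n \<beta> = S. q ^ signed_stat g n \<beta>) = negation_weight S"
      using sum_fixed_negations[OF assms(1,2), of S] by simp
  qed
  also have "\<dots> = q_multinomial q n block_sizes *
      (\<Prod>i=max 1 (\<mu> 1)..<n. 1 + q ^ i)"
    using assms(1,3) by (intro sum_negations_parity) simp_all
  finally show ?thesis .
qed

end

section \<open>Changing the sign of the value 1\<close>

definition flip_one :: "(int \<Rightarrow> int) \<Rightarrow> int \<Rightarrow> int" where
  "flip_one \<beta> = transpose 1 (- 1) \<circ> \<beta>"

lemma flip_one_flip_one [simp]: "flip_one (flip_one \<beta>) = \<beta>"
  by (auto simp: flip_one_def fun_eq_iff)

lemma flip_one_B_group: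
  assumes "\<beta> \<in> B_group n" "n \<ge> 1"
  shows "flip_one \<beta> \<in> B_group n"
proof -
  have "transpose 1 (- 1) permutes ({- int n..int n} - {0})"
    using assms(2) by (intro permutes_swap_id) auto
  moreover have "transpose 1 (- 1) (- x) = - transpose 1 (- 1) x" for x :: int
    by (auto simp: transpose_def)
  ultimately show ?thesis
    using assms(1) B_group_odd[OF assms(1)]
    by (auto simp: B_group_def flip_one_def intro: permutes_compose)
qed

lemma inv_flip_one:
  assumes "\<beta> \<in> B_group n"
  shows "inv (flip_one \<beta>) x = (if \<bar>x\<bar> = 1 then - inv \<beta> x else inv \<beta> x)"
proof -
  have "inv (flip_one \<beta>) = inv \<beta> \<circ> transpose 1 (- 1)"
    unfolding flip_one_def by (subst o_inv_distrib) (auto simp: B_group_bij[OF assms])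
  then show ?thesis
    using B_group_odd[OF B_group_inv[OF assms], of 1] by (auto simp: transpose_def abs_if)
qed

lemma negated_flip_one:
  assumes "\<beta> \<in> B_group n" "n \<ge> 1"
  shows "negated n (flip_one \<beta>) =
    (if 1 \<in> negated n \<beta> then negated n \<beta> - {1} else insert 1 (negated n \<beta>))"
proof -
  have "inv \<beta> 1 \<noteq> 0"
    using B_group_abs_mem_iff[OF B_group_inv[OF assms(1)], of 1] assms(2) by auto
  then show ?thesis
    using assms(2) by (auto simp: negated_def inv_flip_one[OF assms(1)])
qed

lemma even_card_negated_flip_one:
  assumes "\<beta> \<in> B_group n" "n \<ge> 1"
  shows "even (card (negated n (flip_one \<beta>))) \<longleftrightarrow> odd (card (negated n \<beta>))"
  using card.remove[OF finite_negated, of 1 n \<beta>]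
  by (auto simp: negated_flip_one[OF assms] simp del: card_Diff_insert)

lemma N2_flip_one:
  assumes "\<beta> \<in> B_group n" "n \<ge> 1"
  shows "N2 n (flip_one \<beta>) = N2 n \<beta>"
  unfolding N2_eq_sum_negated[OF assms(1)] N2_eq_sum_negated[OF flip_one_B_group[OF assms]]
  by (simp add: negated_flip_one[OF assms] sum_diff1_nat)

lemma window_flip_one: "window n (flip_one \<beta>) = map (transpose 1 (- 1)) (window n \<beta>)"
  by (simp add: window_def flip_one_def)

lemma strict_mono_on_transpose_signed_values:
  "strict_mono_on (signed_values n S) (transpose 1 (- 1))"
  by (rule strict_mono_onI) (auto simp: mem_signed_values transpose_def)

lemma (in mahonian_statistic) signed_stat_flip_one:
  assumes "\<beta> \<in> B_group n" "n \<ge> 1"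
  shows "signed_stat g n (flip_one \<beta>) = signed_stat g n \<beta>"
  using strict_mono_on_transpose_signed_values[of n "negated n \<beta>"]
  by (simp add: signed_stat_def window_flip_one order_invariant set_window N2_flip_one[OF assms]
      flip: signed_values_negated[OF assms(1)])

lemma Des_D_flip_one:
  assumes "\<beta> \<in> B_group n" "n \<ge> 2"
  shows "Des_D n (inv (flip_one \<beta>)) = transpose 0 1 ` Des_D n (inv \<beta>)"
proof -
  have "i \<in> Des_D n (inv (flip_one \<beta>)) \<longleftrightarrow> transpose 0 1 i \<in> Des_D n (inv \<beta>)" for i
  proof -
    consider "i = 0" | "i = 1" | "i \<ge> 2"
      by linarith
    then show ?thesis
      using assms(2) by cases (auto simp: Des_D_def inv_flip_one[OF assms(1)])
  qed
  then show ?thesis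
    unfolding set_eq_iff in_transpose_image_iff by blast
qed

lemma flip_one_D_coset_of:
  assumes "n \<ge> 2" "\<beta> \<in> D_coset_of n M e"
  shows "flip_one \<beta> \<in> D_coset_of n (transpose 0 1 ` M) (\<not> e)"
  using assms
  by (auto simp: D_coset_of_def flip_one_B_group Des_D_flip_one even_card_negated_flip_one
      simp del: transpose_image_eq intro!: image_mono)

lemma bij_betw_flip_one:
  assumes "n \<ge> 2"
  shows "bij_betw flip_one (D_coset_of n M e) (D_coset_of n (transpose 0 1 ` M) (\<not> e))"
proof (rule bij_betw_byWitness[of _ flip_one])
  show "flip_one ` D_coset_of n (transpose 0 1 ` M) (\<not> e) \<subseteq> D_coset_of n M e"
    using flip_one_D_coset_of[OF assms, of _ "transpose 0 1 ` M" "\<not> e"]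
    by (auto simp: image_comp)
qed (use flip_one_D_coset_of[OF assms] in auto)

lemma (in mahonian_statistic) sum_D_coset_of_flip_one:
  assumes "n \<ge> 2"
  shows "(\<Sum>\<beta>\<in>D_coset_of n M e. q ^ signed_stat g n \<beta>) =
    (\<Sum>\<beta>\<in>D_coset_of n (transpose 0 1 ` M) (\<not> e). q ^ signed_stat g n \<beta>)"
proof -
  have "(\<Sum>\<beta>\<in>D_coset_of n M e. q ^ signed_stat g n \<beta>) =
      (\<Sum>\<beta>\<in>D_coset_of n M e. q ^ signed_stat g n (flip_one \<beta>))"
    using assms by (intro sum.cong) (auto simp: D_coset_of_def signed_stat_flip_one)
  then show ?thesis
    using sum.reindex_bij_betw[OF bij_betw_flip_one[OF assms]] by simp
qed

section \<open>Enumerated descent sets\<close>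

locale enumerated_descents =
  fixes n t :: nat and m :: "nat \<Rightarrow> nat" and M :: "nat set"
  assumes two_le: "n \<ge> 2"
    and subset: "M \<subseteq> {0..n-1}"
    and image: "M = m ` {1..t}"
    and strict_mono: "strict_mono_on {1..t} m"
    and final: "m (t + 1) = n"
begin

lemma less_Suc:
  assumes "1 \<le> j" "j \<le> t"
  shows "m j < m (Suc j)"
proof (cases "j = t")
  case True
  have "m j \<in> M"
    using assms image by auto
  then have "m j < n"
    using subset two_le by auto
  then show ?thesis
    using True final by simp
qed (use assms strict_mono in \<open>auto simp: strict_mono_on_def\<close>)

lemma first_le: "x \<in> M \<Longrightarrow> m 1 \<le> x"
  using strict_mono_on_leD[OF strict_mono] unfolding image by force

lemma first_mem: "m 1 \<noteq> n \<Longrightarrow> m 1 \<in> M"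
  using final unfolding image by (cases t) auto

lemma first_eq_0_iff: "m 1 = 0 \<longleftrightarrow> 0 \<in> M"
  using first_mem first_le[of 0] two_le by auto

lemma first_eq_1_iff: "m 1 = 1 \<longleftrightarrow> 0 \<notin> M \<and> 1 \<in> M"
  using first_mem first_le[of 0] first_le[of 1] first_eq_0_iff two_le by (cases "m 1") auto

end

lemma (in mahonian_statistic) sum_D_of_first_neq_1:
  assumes "enumerated_descents n t m M" "m 1 \<noteq> 1" "(2::'q) \<noteq> 0"
  shows "(\<Sum>\<gamma>\<in>D_of n M. q ^ signed_stat g n \<gamma>) =
    q_multinomial q n (m 1 # map (\<lambda>i. m (i + 1) - m i) [1..<t + 1]) * (\<Prod>i=max 1 (m 1)..n-1. 1 + q ^ i)"
proof -
  interpret descents: enumerated_descents n t m M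
    by fact
  let ?\<mu> = "m(0 := 0)"
  interpret mahonian_block_partition n t ?\<mu> q g
  proof
    show "?\<mu> j \<le> ?\<mu> (Suc j)" if "j \<le> t" for j
      using descents.less_Suc[of j] that by (cases "j = 0") auto
  qed (use descents.final in auto)
  have "M = ?\<mu> ` {1..t}"
    by (auto simp: descents.image)
  moreover have "{max 1 (m 1)..n-1} = {max 1 (m 1)..<n}"
    using descents.two_le by auto
  moreover have "block_sizes = m 1 # map (\<lambda>i. m (i + 1) - m i) [1..<t + 1]"
    by (simp add: block_sizes_def upt_conv_Cons del: upt_Suc)
  ultimately show ?thesis
    using sum_D_coset_of[OF descents.two_le _ assms(3), of True] assms(2)
    by (simp add: D_of_eq_D_coset_of del: upt_Suc)
qed

lemma (in generic_q) q_multinomial_0_Cons: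
  assumes "a > 0"
  shows "q_multinomial q n (0 # a # as) = q_multinomial q n (1 # (a - 1) # as) / q_int q a"
  using assms by (cases a) (simp_all add: q_multinomial_def q_fact_Suc q_int_Suc)

lemma (in mahonian_statistic) sum_D_of_first_eq_1:
  assumes "enumerated_descents n t m M" "m 1 = 1" "(2::'q) \<noteq> 0"
  shows "(\<Sum>\<gamma>\<in>D_of n M. q ^ signed_stat g n \<gamma>) =
    q_multinomial q n (m 1 # map (\<lambda>i. m (i + 1) - m i) [1..<t + 1]) *
      ((\<Prod>i=1..n-1. 1 + q ^ i) / q_int q (m 2))"
proof -
  interpret descents: enumerated_descents n t m M
    by fact
  let ?\<mu> = "m(0 := 0, 1 := 0)"
  have t: "t \<ge> 1"
    using assms(2) descents.final descents.two_le by (cases t) auto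
  then have second: "m 2 > 1"
    using descents.less_Suc[of 1] assms(2) by (simp add: numeral_2_eq_2)
  interpret mahonian_block_partition n t ?\<mu> q g
  proof
    show "?\<mu> j \<le> ?\<mu> (Suc j)" if "j \<le> t" for j
      using descents.less_Suc[of j] that by auto
  qed (use t descents.final in auto)
  have upt: "[0..<Suc t] = 0 # 1 # [2..<t + 1]" "[1..<t + 1] = 1 # [2..<t + 1]"
    using t by (simp_all add: upt_conv_Cons numeral_2_eq_2 del: upt_Suc)
  have "transpose 0 1 (m j) = ?\<mu> j" if "j \<in> {1..t}" for j
    using strict_mono_onD[OF descents.strict_mono, of 1 j] that assms(2)
    by (cases "j = 1") (auto simp: transpose_def)
  then have "transpose 0 1 ` M = ?\<mu> ` {1..t}"
    unfolding descents.image image_image by (rule image_cong[OF refl])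
  then have "(\<Sum>\<gamma>\<in>D_of n M. q ^ signed_stat g n \<gamma>) =
      q_multinomial q n block_sizes * (\<Prod>i=max 1 (?\<mu> 1)..<n. 1 + q ^ i)"
    using sum_D_coset_of[OF descents.two_le _ assms(3), of False]
      sum_D_coset_of_flip_one[OF descents.two_le, of M True]
    by (simp add: D_of_eq_D_coset_of del: upt_Suc)
  moreover have "block_sizes = 0 # m 2 # map (\<lambda>i. m (i + 1) - m i) [2..<t + 1]"
    "m 1 # map (\<lambda>i. m (i + 1) - m i) [1..<t + 1] = 1 # (m 2 - 1) # map (\<lambda>i. m (i + 1) - m i) [2..<t + 1]"
    unfolding block_sizes_def upt using assms(2) by (simp_all add: numeral_2_eq_2)
  moreover have "{1..n - 1} = {1..<n}"
    using descents.two_le by auto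
  ultimately show ?thesis
    using second by (simp only: q_multinomial_0_Cons) simp
qed

lemma q_var_pos: "q_var > 0"
  by (simp add: q_var_def zero_less_Fract_iff less_poly_def pos_poly_def)

theorem theorem4p5:
  fixes n t :: nat and m :: "nat \<Rightarrow> nat" and M :: "nat set"
  assumes "n \<ge> 2"
    and "M \<subseteq> {0..n-1}"
    and "M = m ` {1..t}"
    and "strict_mono_on {1..t} m"
    and "m (t + 1) = n"
  shows "let q = q_var;
             C = q_multinomial q n (m 1 # map (\<lambda>i. m (i + 1) - m i) [1..<t + 1])
         in (\<Sum>\<gamma>\<in>D_of n M. q ^ dmaj n \<gamma>) = (\<Sum>\<gamma>\<in>D_of n M. q ^ length_D n \<gamma>) \<and>
            (\<Sum>\<gamma>\<in>D_of n M. q ^ length_D n \<gamma>) =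
              (if 0 \<in> M then C * (\<Prod>i=1..n-1. 1 + q ^ i)
               else if 1 \<notin> M then C * (\<Prod>i=m 1..n-1. 1 + q ^ i)
               else C * ((\<Prod>i=1..n-1. 1 + q ^ i) / q_int q (m 2)))"
proof -
  interpret generic_q q_var
    by (rule generic_q_of_pos[OF q_var_pos])
  interpret maj: mahonian_statistic q_var list_maj
    by (rule mahonian_statistic_list_maj)
  interpret inv: mahonian_statistic q_var list_inv
    by (rule mahonian_statistic_list_inv)
  have descents: "enumerated_descents n t m M"
    using assms by unfold_locales
  note first = enumerated_descents.first_eq_0_iff[OF descents]
    enumerated_descents.first_eq_1_iff[OF descents]
  show ?thesis
  proof (cases "m 1 = 1")
    case True
    then show ?thesis
      using maj.sum_D_of_first_eq_1[OF descents] inv.sum_D_of_first_eq_1[OF descents] first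
      by (simp add: dmaj_eq_signed_stat length_D_eq_signed_stat Let_def del: upt_Suc)
  next
    case False
    moreover have "max 1 (m 1) = (if 0 \<in> M then 1 else m 1)"
      using first(1) by auto
    ultimately show ?thesis
      using maj.sum_D_of_first_neq_1[OF descents] inv.sum_D_of_first_neq_1[OF descents] first
      by (auto simp: dmaj_eq_signed_stat length_D_eq_signed_stat Let_def simp del: upt_Suc)
  qed
qed

end
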